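(* Let $r\le s$ and let $A\in\mathbb{C}_r^{m\times n}$, $\widetilde A=A+E\in\mathbb{C}_s^{m\times n}$ have the generalized polar decompositions $A=QH$ and $\widetilde A=\widetilde Q\widetilde H$. Then $$\|A+\widetilde A\|_F\le\sqrt{\frac{G_{r,r}}{\sqrt{F_{r,s}^2+2G_{r,r}F_{r,s}}-F_{r,s}}}\;\|H+\widetilde H\|_F,$$ where $F_{r,s}:=\sum_{j=1}^r\sigma_j^2+\sum_{j=1}^s\widetilde\sigma_j^2$, $G_{r,r}:=\sum_{j=1}^r\sigma_j\widetilde\sigma_j$, and the coefficient is optimal.
   Context: $\mathbb{C}^{m\times n}$ is the set of complex $m\times n$ matrices and $\mathbb{C}_r^{m\times n}$ is the subset of those of rank $r$; $\|\cdot\|_F$ is the Frobenius norm; $A^*$ is the conjugate transpose of $A$ and $|A|:=(A^*A)^{1/2}$. For $A\in\mathbb{C}_r^{m\times n}$, the generalized polar decomposition is $A=QH$ with $Q\in\mathbb{C}_r^{m\times n}$ subunitary (a partial isometry) and $H\in\mathbb{C}_r^{n\times n}$ positive semidefinite; it is unique under the condition $\mathcal R(Q^* )=\mathcal R(H)$ (where $\mathcal R$ denotes the column space), and then $H=|A|$ and $\widetilde H=|\widetilde A|$. $Q$ is the subunitary polar factor and $H$ the positive polar factor. The nonzero singular values of $A$ and $\widetilde A$, in decreasing order, are $\sigma_1\ge\dots\ge\sigma_r>0$ and $\widetilde\sigma_1\ge\dots\ge\widetilde\sigma_s>0$, respectively. *)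

theory Defs
  imports
    "HOL-Computational_Algebra.Computational_Algebra"
    "Jordan_Normal_Form.Schur_Decomposition"
    "Jordan_Normal_Form.Matrix_Kernel"
    "Jordan_Normal_Form.DL_Rank"
begin

definition frobenius_norm :: "complex mat \<Rightarrow> real" where
  "frobenius_norm A = sqrt (\<Sum>i<dim_row A. \<Sum>j<dim_col A. (cmod (A $$ (i, j)))\<^sup>2)"

(* The order on complex numbers is the one of HOL-Library.Complex_Order:
   0 \<le> z means that z is real and nonnegative. *)
definition positive_semidefinite :: "complex mat \<Rightarrow> bool" where
  "positive_semidefinite H \<longleftrightarrow>
     H \<in> carrier_mat (dim_col H) (dim_col H) \<and> mat_adjoint H = H \<and>
     (\<forall>x \<in> carrier_vec (dim_col H). 0 \<le> (H *\<^sub>v x) \<bullet>c x)"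

(* A partial isometry: isometric on the orthogonal complement of its kernel. *)
definition subunitary :: "complex mat \<Rightarrow> bool" where
  "subunitary Q \<longleftrightarrow>
     (\<forall>x \<in> carrier_vec (dim_col Q). (\<forall>z \<in> mat_kernel Q. x \<bullet>c z = 0) \<longrightarrow>
        (Q *\<^sub>v x) \<bullet>c (Q *\<^sub>v x) = x \<bullet>c x)"

(* The last clause is the range condition R(Q^* ) = R(H), which makes the
   decomposition unique. *)
definition gen_polar_decomposition ::
    "nat \<Rightarrow> nat \<Rightarrow> complex mat \<Rightarrow> complex mat \<Rightarrow> complex mat \<Rightarrow> bool" where
  "gen_polar_decomposition m n A Q H \<longleftrightarrow>
     A \<in> carrier_mat m n \<and> Q \<in> carrier_mat m n \<and> H \<in> carrier_mat n n \<and>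
     A = Q * H \<and> subunitary Q \<and> positive_semidefinite H \<and>
     vec_space.rank m Q = vec_space.rank m A \<and>
     vec_space.rank n H = vec_space.rank m A \<and>
     vec_space.col_space n (mat_adjoint Q) = vec_space.col_space n H"

(* The square roots of the nonzero eigenvalues of A^* A, repeated according to
   multiplicity, in decreasing order.  List indices start at 0, so the j-th
   singular value of A is  nonzero_singular_values A ! (j - 1). *)
definition nonzero_singular_values :: "complex mat \<Rightarrow> real list" where
  "nonzero_singular_values A =
     rev (sorted_list_of_multiset
       {# sqrt (Re z). z \<in># filter_mset (\<lambda>z. z \<noteq> 0) (proots (char_poly (mat_adjoint A * A))) #})"

definition F_sum :: "nat \<Rightarrow> nat \<Rightarrow> complex mat \<Rightarrow> complex mat \<Rightarrow> real" where
  "F_sum r s A B = (\<Sum>j<r. (nonzero_singular_values A ! j)\<^sup>2) +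
                   (\<Sum>j<s. (nonzero_singular_values B ! j)\<^sup>2)"

definition G_sum :: "nat \<Rightarrow> complex mat \<Rightarrow> complex mat \<Rightarrow> real" where
  "G_sum r A B = (\<Sum>j<r. nonzero_singular_values A ! j * nonzero_singular_values B ! j)"

definition polar_coefficient :: "nat \<Rightarrow> nat \<Rightarrow> complex mat \<Rightarrow> complex mat \<Rightarrow> real" where
  "polar_coefficient r s A B =
     sqrt (G_sum r A B /
       (sqrt ((F_sum r s A B)\<^sup>2 + 2 * G_sum r A B * F_sum r s A B) - F_sum r s A B))"

end

theory Submission
  imports Defs "HOL-Analysis.L2_Norm"
begin

text \<open>
  Let \<open>A = Q H\<close> and \<open>B = P K\<close> be the two decompositions, of ranks \<open>r \<le> s\<close>. The range condition makes
  \<open>Q\<close> isometric on the range of \<open>H\<close>, so \<open>A\<^sup>* A = H\<^sup>2\<close> (\<open>gen_polar_decomposition_gram\<close>). Hence \<open>A\<close> and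
  \<open>H\<close> have the same Frobenius norm, and so have \<open>B\<close> and \<open>K\<close>. With \<open>F\<close> the sum of the squares of all
  singular values, the squared norms to be compared are \<open>F + 2 u\<close> for \<open>A + B\<close> and \<open>F + 2 t\<close> for
  \<open>H + K\<close>, where \<open>u = Re tr (A\<^sup>* B)\<close> and \<open>t = tr (H K)\<close>.

  The heart of the matter is \<open>u\<^sup>2 \<le> G t\<close> (\<open>trace_cross_term_bound\<close>). Unitary diagonalizations
  \<open>H = U D U\<^sup>*\<close> and \<open>K = V E V\<^sup>*\<close> with decreasing diagonals \<open>d\<close> and \<open>e\<close>
  turn both cross terms into double sums: \<open>t\<close> is the sum of the
  \<open>|M i j|\<^sup>2\<close>, \<open>M = U\<^sup>* V\<close>, with weights \<open>d i * e j\<close>, and \<open>u\<close> is at most the sum of the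
  \<open>|M i j| * |Z i j|\<close>, where \<open>Z\<close> holds the inner products of the orthogonal columns of \<open>A U\<close> and
  \<open>B V\<close>. The Cauchy-Schwarz inequality separates \<open>t\<close> from a sum of weights \<open>d i * e j\<close> against a
  matrix that is doubly substochastic by Bessel's inequality, and such a sum is at most
  \<open>G = \<Sum>i. d i * e i\<close> (\<open>substochastic_sum_le\<close>).

  It remains to maximize \<open>(F + 2 \<surd>(G t)) / (F + 2 t)\<close> over \<open>t \<ge> 0\<close>. With
  \<open>\<delta> = \<surd>(F\<^sup>2 + 2 G F) - F\<close> the maximum is \<open>G / \<delta>\<close>, attained at \<open>t = c\<^sup>2 G\<close>, \<open>c = \<delta> / (2 G)\<close>
  (\<open>ratio_le_polar_coefficient\<close>).

  For optimality both steps must be equalities for a pair with the given singular values, that is,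
  \<open>t = c\<^sup>2 G\<close> and \<open>u = c G\<close>. This happens when corresponding right singular vectors of the two matrices
  enclose an angle with cosine \<open>c\<close> (which is at most \<open>1/2\<close>), corresponding left singular vectors
  coincide, and all other pairs are orthogonal (\<open>extremal_polar_pair\<close>).
\<close>

section \<open>Adjoint, trace and Frobenius norm\<close>

lemma mat_adjoint_dim [simp]:
  "dim_row (mat_adjoint A) = dim_col A" "dim_col (mat_adjoint A) = dim_row A"
  by (simp_all add: mat_adjoint_def)

lemma mat_adjoint_carrier [simp]:
  "A \<in> carrier_mat m n \<Longrightarrow> mat_adjoint A \<in> carrier_mat n m"
  by (metis carrier_matD carrier_matI mat_adjoint_dim)

lemma mat_adjoint_index [simp]:
  fixes A :: "complex mat"
  assumes "i < dim_col A" "j < dim_row A"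
  shows "mat_adjoint A $$ (i, j) = cnj (A $$ (j, i))"
  using assms by (simp add: mat_adjoint_def mat_of_rows_index)

lemma mat_adjoint_adjoint [simp]:
  fixes A :: "complex mat"
  shows "mat_adjoint (mat_adjoint A) = A"
  by (rule eq_matI) simp_all

lemma mat_mult_index:
  assumes "i < dim_row A" "j < dim_col B" "dim_col A = dim_row B"
  shows "(A * B) $$ (i, j) = (\<Sum>k<dim_row B. A $$ (i, k) * B $$ (k, j))"
  using assms by (simp add: scalar_prod_def atLeast0LessThan)

lemma mat_adjoint_mult:
  fixes A B :: "complex mat"
  assumes "dim_col A = dim_row B"
  shows "mat_adjoint (A * B) = mat_adjoint B * mat_adjoint A"
  by (rule eq_matI) (use assms in \<open>auto simp: mat_mult_index mult.commute simp del: index_mult_mat(1)\<close>)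

lemma mat_adjoint_add:
  fixes A B :: "complex mat"
  assumes "dim_row A = dim_row B" "dim_col A = dim_col B"
  shows "mat_adjoint (A + B) = mat_adjoint A + mat_adjoint B"
  by (rule eq_matI) (use assms in auto)

lemma mat_adjoint_minus:
  fixes A B :: "complex mat"
  assumes "dim_row A = dim_row B" "dim_col A = dim_col B"
  shows "mat_adjoint (A - B) = mat_adjoint A - mat_adjoint B"
  by (rule eq_matI) (use assms in auto)

lemma mat_adjoint_one [simp]: "mat_adjoint (1\<^sub>m n :: complex mat) = 1\<^sub>m n"
  by (rule eq_matI) auto

lemma mat_mult_assoc:
  fixes A B C :: "'a :: semiring_0 mat"
  assumes "dim_col A = dim_row B" "dim_col B = dim_row C"
  shows "A * B * C = A * (B * C)"
  by (rule assoc_mult_mat) (use assms in auto)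

lemma mat_mult_minus_right:
  fixes A B C :: "'a :: ring mat"
  assumes "dim_col A = dim_row B" "dim_row B = dim_row C" "dim_col B = dim_col C"
  shows "A * (B - C) = A * B - A * C"
  by (rule mult_minus_distrib_mat[of _ "dim_row A" "dim_col A" _ "dim_col B"])
    (use assms in \<open>auto intro!: carrier_matI\<close>)

lemma mat_mult_minus_left:
  fixes A B C :: "'a :: ring mat"
  assumes "dim_row A = dim_row B" "dim_col A = dim_col B" "dim_col A = dim_row C"
  shows "(A - B) * C = A * C - B * C"
  by (rule minus_mult_distrib_mat[of _ "dim_row A" "dim_col A" _ _ "dim_col C"])
    (use assms in \<open>auto intro!: carrier_matI\<close>)

abbreviation real_diag :: "nat \<Rightarrow> (nat \<Rightarrow> real) \<Rightarrow> complex mat" where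
  "real_diag n d \<equiv> mat_diag n (\<lambda>i. complex_of_real (d i))"

lemma mat_diag_dims [simp]:
  "dim_row (mat_diag n f) = n" "dim_col (mat_diag n f) = n"
  by (simp_all add: mat_diag_def)

lemma mat_adjoint_real_diag [simp]: "mat_adjoint (real_diag n d) = real_diag n d"
  by (rule eq_matI) (auto simp: mat_diag_def)

definition mat_trace :: "complex mat \<Rightarrow> complex" where
  "mat_trace A = (\<Sum>i<dim_row A. A $$ (i, i))"

lemma mat_trace_mult_commute:
  assumes "dim_col A = dim_row B" "dim_col B = dim_row A"
  shows "mat_trace (A * B) = mat_trace (B * A)"
proof -
  have "mat_trace (A * B) = (\<Sum>i<dim_row A. \<Sum>k<dim_row B. A $$ (i, k) * B $$ (k, i))"
    unfolding mat_trace_def using assms by (simp add: mat_mult_index del: index_mult_mat(1))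
  also have "\<dots> = (\<Sum>k<dim_row B. \<Sum>i<dim_row A. B $$ (k, i) * A $$ (i, k))"
    by (subst sum.swap) (simp add: mult.commute)
  also have "\<dots> = mat_trace (B * A)"
    unfolding mat_trace_def using assms by (simp add: mat_mult_index del: index_mult_mat(1))
  finally show ?thesis .
qed

lemma mat_trace_add:
  assumes "dim_row A = dim_row B" "dim_col B = dim_row B"
  shows "mat_trace (A + B) = mat_trace A + mat_trace B"
  using assms by (simp add: mat_trace_def sum.distrib)

lemma mat_trace_adjoint:
  assumes "dim_row A = dim_col A"
  shows "mat_trace (mat_adjoint A) = cnj (mat_trace A)"
  using assms by (simp add: mat_trace_def)

lemma mat_trace_adjoint_mult:
  assumes "dim_row A = dim_row B" "dim_col A = dim_col B"
  shows "mat_trace (mat_adjoint A * B) = (\<Sum>i<dim_row A. \<Sum>j<dim_col A. cnj (A $$ (i, j)) * B $$ (i, j))"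
  using assms unfolding mat_trace_def
  by (subst sum.swap) (simp add: mat_mult_index del: index_mult_mat(1))

lemma frobenius_norm_sq: "(frobenius_norm A)\<^sup>2 = Re (mat_trace (mat_adjoint A * A))"
  by (simp add: frobenius_norm_def mat_trace_adjoint_mult sum_nonneg cmod_power2 flip: power2_eq_square)

lemma frobenius_norm_nonneg: "0 \<le> frobenius_norm A"
  by (simp add: frobenius_norm_def sum_nonneg)

lemma frobenius_norm_add_sq:
  assumes "A \<in> carrier_mat m n" "B \<in> carrier_mat m n"
  shows "(frobenius_norm (A + B))\<^sup>2 =
    (frobenius_norm A)\<^sup>2 + (frobenius_norm B)\<^sup>2 + 2 * Re (mat_trace (mat_adjoint A * B))"
proof -
  have "mat_adjoint (A + B) * (A + B) =
      (mat_adjoint A * A + mat_adjoint B * A) + (mat_adjoint A * B + mat_adjoint B * B)"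
    using assms by (simp add: mat_adjoint_add mult_add_distrib_mat[of _ n m _ n]
       add_mult_distrib_mat[of _ n m _ _ n])
  moreover have "Re (mat_trace (mat_adjoint B * A)) = Re (mat_trace (mat_adjoint A * B))"
    using mat_trace_adjoint[of "mat_adjoint A * B"] assms by (simp add: mat_adjoint_mult)
  ultimately show ?thesis
    using assms by (simp add: frobenius_norm_sq mat_trace_add)
qed

section \<open>Rearrangement with doubly substochastic weights\<close>

text \<open>
  Summation by parts, as an induction: the bound \<open>c\<close> is raised to the last weight before that
  weight is split off. With \<open>c = 0\<close> this says that decreasing nonnegative weights keep the
  order of prefix sums.
\<close>

lemma sum_nonneg_of_prefix_sums_nonneg:
  fixes d z :: "nat \<Rightarrow> real"
  assumes "\<And>i j. i \<le> j \<Longrightarrow> j < n \<Longrightarrow> d j \<le> d i"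
    and "\<And>k. k \<le> n \<Longrightarrow> 0 \<le> (\<Sum>i<k. z i)"
    and "0 \<le> c" and "\<And>i. i < n \<Longrightarrow> c \<le> d i"
  shows "c * (\<Sum>i<n. z i) \<le> (\<Sum>i<n. d i * z i)"
  using assms
proof (induction n arbitrary: c)
  case 0
  then show ?case by simp
next
  case (Suc n)
  have "d n * (\<Sum>i<n. z i) \<le> (\<Sum>i<n. d i * z i)"
  proof (rule Suc.IH)
    show "d j \<le> d i" if "i \<le> j" "j < n" for i j using Suc.prems(1)[of i j] that by simp
    show "0 \<le> (\<Sum>i<k. z i)" if "k \<le> n" for k using Suc.prems(2)[of k] that by simp
    show "0 \<le> d n" using Suc.prems(3) Suc.prems(4)[of n] by simp
    show "d n \<le> d i" if "i < n" for i using Suc.prems(1)[of i n] that by simp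
  qed
  moreover have "c * (\<Sum>i<Suc n. z i) \<le> d n * (\<Sum>i<Suc n. z i)"
    using Suc.prems(2)[of "Suc n"] Suc.prems(4)[of n] by (intro mult_right_mono) auto
  ultimately show ?case by (simp add: algebra_simps)
qed

lemma sum_mult_mono_prefix_sums:
  fixes d x y :: "nat \<Rightarrow> real"
  assumes "antimono d" "\<And>i. 0 \<le> d i"
    and "\<And>k. k \<le> n \<Longrightarrow> (\<Sum>i<k. x i) \<le> (\<Sum>i<k. y i)"
  shows "(\<Sum>i<n. d i * x i) \<le> (\<Sum>i<n. d i * y i)"
proof -
  have "0 * (\<Sum>i<n. y i - x i) \<le> (\<Sum>i<n. d i * (y i - x i))"
  proof (rule sum_nonneg_of_prefix_sums_nonneg)
    show "d j \<le> d i" if "i \<le> j" "j < n" for i j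
      using assms(1) that(1) by (rule antimonoD)
  qed (simp_all add: assms sum_subtractf)
  then show ?thesis by (simp add: algebra_simps sum_subtractf)
qed

text \<open>
  The rearrangement bound behind von Neumann's trace inequality. Two summations by parts reduce it to
  weights that are indicators of initial segments \<open>{..<k}\<close> and \<open>{..<l}\<close>: the sum of \<open>S\<close> over the
  rectangle that they span is at most \<open>min k l\<close>, by columns if \<open>l \<le> k\<close> and by rows otherwise.
\<close>

lemma substochastic_sum_le:
  fixes d e :: "nat \<Rightarrow> real" and S :: "nat \<Rightarrow> nat \<Rightarrow> real"
  assumes d: "antimono d" "\<And>i. 0 \<le> d i" and e: "antimono e" "\<And>i. 0 \<le> e i"
    and S: "\<And>i j. i < n \<Longrightarrow> j < n \<Longrightarrow> 0 \<le> S i j"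
    and row: "\<And>i. i < n \<Longrightarrow> (\<Sum>j<n. S i j) \<le> 1"
    and col: "\<And>j. j < n \<Longrightarrow> (\<Sum>i<n. S i j) \<le> 1"
  shows "(\<Sum>i<n. \<Sum>j<n. d i * e j * S i j) \<le> (\<Sum>i<n. d i * e i)"
proof -
  have prefix: "(\<Sum>i<k. \<Sum>j<n. e j * S i j) \<le> (\<Sum>i<k. e i)" if k: "k \<le> n" for k
  proof -
    \<comment> \<open>The indicator of \<open>{..<k}\<close> has prefix sums \<open>min k l\<close>.\<close>
    have le: "(\<Sum>j<l. \<Sum>i<k. S i j) \<le> (\<Sum>j<l. if j < k then 1 else 0)" if l: "l \<le> n" for l
    proof (cases "l \<le> k")
      case True
      have "(\<Sum>i<k. S i j) \<le> 1" if "j < l" for j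
      proof -
        have "(\<Sum>i<k. S i j) \<le> (\<Sum>i<n. S i j)"
          using that k l S by (intro sum_mono2) auto
        then show ?thesis using col[of j] that l by linarith
      qed
      then have "(\<Sum>j<l. \<Sum>i<k. S i j) \<le> (\<Sum>j<l. 1)" by (intro sum_mono) simp
      also have "\<dots> = (\<Sum>j<l. if j < k then 1 else 0)"
        using True by (intro sum.cong) auto
      finally show ?thesis .
    next
      case False
      have "(\<Sum>j<l. \<Sum>i<k. S i j) = (\<Sum>i<k. \<Sum>j<l. S i j)" by (rule sum.swap)
      also have "\<dots> \<le> (\<Sum>i<k. 1)"
      proof (rule sum_mono)
        fix i assume "i \<in> {..<k}"
        then have "(\<Sum>j<l. S i j) \<le> (\<Sum>j<n. S i j)"
          using k l S by (intro sum_mono2) auto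
        then show "(\<Sum>j<l. S i j) \<le> 1" using row[of i] k \<open>i \<in> {..<k}\<close> by simp
      qed
      also have "\<dots> = (\<Sum>j\<in>{..<l} \<inter> {j. j < k}. 1)"
      proof -
        have "{..<l} \<inter> {j. j < k} = {..<k}" using False by auto
        then show ?thesis by simp
      qed
      also have "\<dots> = (\<Sum>j<l. if j < k then 1 else 0)"
        by (subst sum.inter_restrict) auto
      finally show ?thesis .
    qed
    have "(\<Sum>i<k. \<Sum>j<n. e j * S i j) = (\<Sum>j<n. e j * (\<Sum>i<k. S i j))"
      by (subst sum.swap) (simp add: sum_distrib_left)
    also have "\<dots> \<le> (\<Sum>j<n. e j * (if j < k then 1 else 0))"
      using le by (intro sum_mult_mono_prefix_sums e)
    also have "\<dots> = (\<Sum>j\<in>{..<n} \<inter> {j. j < k}. e j)"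
      by (subst sum.inter_restrict) (auto intro: sum.cong)
    also have "\<dots> = (\<Sum>i<k. e i)"
      using k by (intro sum.cong) auto
    finally show ?thesis .
  qed
  have "(\<Sum>i<n. \<Sum>j<n. d i * e j * S i j) = (\<Sum>i<n. d i * (\<Sum>j<n. e j * S i j))"
    by (simp add: sum_distrib_left mult.assoc)
  also have "\<dots> \<le> (\<Sum>i<n. d i * e i)"
    using prefix by (intro sum_mult_mono_prefix_sums d)
  finally show ?thesis .
qed

section \<open>Unitary diagonalization\<close>

definition unitary_mat :: "nat \<Rightarrow> complex mat \<Rightarrow> bool" where
  "unitary_mat n U \<longleftrightarrow> U \<in> carrier_mat n n \<and> mat_adjoint U * U = 1\<^sub>m n"

lemma unitary_matD:
  assumes "unitary_mat n U"
  shows "U \<in> carrier_mat n n" "dim_row U = n" "dim_col U = n"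
    "mat_adjoint U * U = 1\<^sub>m n" "U * mat_adjoint U = 1\<^sub>m n"
proof -
  show U: "U \<in> carrier_mat n n" and id: "mat_adjoint U * U = 1\<^sub>m n"
    using assms by (auto simp: unitary_mat_def)
  show "dim_row U = n" "dim_col U = n" using U by auto
  show "U * mat_adjoint U = 1\<^sub>m n"
    using mat_mult_left_right_inverse[of "mat_adjoint U" n U] U id by simp
qed

lemma unitary_mat_cancel:
  assumes "unitary_mat n U" "dim_row X = n"
  shows "mat_adjoint U * (U * X) = X" "U * (mat_adjoint U * X) = X"
proof -
  note D = unitary_matD[OF assms(1)]
  have X: "X \<in> carrier_mat n (dim_col X)" using assms(2) by auto
  show "mat_adjoint U * (U * X) = X"
    using D(4) X by (subst mat_mult_assoc[symmetric]) (simp_all add: D(2,3) assms)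
  show "U * (mat_adjoint U * X) = X"
    using D(5) X by (subst mat_mult_assoc[symmetric]) (simp_all add: D(2,3) assms)
qed

lemma unitary_mat_mult:
  assumes "unitary_mat n U" "unitary_mat n V"
  shows "unitary_mat n (U * V)"
  using assms unitary_matD[OF assms(1)] unitary_matD[OF assms(2)]
  by (simp add: unitary_mat_def mat_adjoint_mult mat_mult_assoc unitary_mat_cancel)

lemma unitary_mat_adjoint:
  assumes "unitary_mat n U"
  shows "unitary_mat n (mat_adjoint U)"
  using unitary_matD[OF assms] by (simp add: unitary_mat_def)

lemma unitary_mat_one: "unitary_mat n (1\<^sub>m n)"
  by (simp add: unitary_mat_def)

text \<open>
  Gram-Schmidt applied to a basis that starts with \<open>v\<close>; the columns are then divided by their
  lengths, so the first one is only proportional to \<open>v\<close>.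
\<close>

lemma unitary_mat_with_first_column:
  fixes v :: "complex vec"
  assumes v: "v \<in> carrier_vec n" "v \<noteq> 0\<^sub>v n"
  shows "\<exists>W c. unitary_mat n W \<and> col W 0 = c \<cdot>\<^sub>v v"
proof -
  interpret cof_vec_space n "TYPE(complex)" .
  define b where "b = basis_completion v"
  define ws where "ws = gram_schmidt n b"
  from basis_completion[OF v, folded b_def]
  have dist_b: "distinct b" and indep: "\<not> lin_dep (set b)" and b: "set b \<subseteq> carrier_vec n"
    and hdb: "hd b = v" and len_b: "length b = n" by auto
  have n: "n > 0" using v by (cases n) auto
  from hdb len_b n obtain vs where bv: "b = v # vs" by (cases b) auto
  from gram_schmidt_result[OF b dist_b indep refl, folded ws_def]
  have ws: "set ws \<subseteq> carrier_vec n" "corthogonal ws" "length ws = n"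
    by (auto simp: len_b)
  have hdws: "ws ! 0 = v"
    using gram_schmidt_hd[OF v(1), of vs, folded bv] ws n
    by (metis ws_def hd_conv_nth length_greater_0_conv)
  define N where "N j = sqrt (Re (ws ! j \<bullet>c ws ! j))" for j
  define W where "W = mat n n (\<lambda>(i, j). ws ! j $ i / complex_of_real (N j))"
  have wsc: "ws ! j \<in> carrier_vec n" if "j < n" for j using ws that by auto
  have sq: "ws ! j \<bullet>c ws ! j = complex_of_real ((N j)\<^sup>2)" "N j > 0" if j: "j < n" for j
  proof -
    have "ws ! j \<bullet>c ws ! j \<noteq> 0" using corthogonalD[OF ws(2), of j j] ws(3) j by simp
    moreover have "ws ! j \<bullet>c ws ! j \<ge> 0" by (rule conjugate_square_ge_0_vec)
    ultimately have *: "Re (ws ! j \<bullet>c ws ! j) > 0" "Im (ws ! j \<bullet>c ws ! j) = 0"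
      by (auto simp: less_eq_complex_def complex_eq_iff)
    then show "N j > 0" "ws ! j \<bullet>c ws ! j = complex_of_real ((N j)\<^sup>2)"
      by (auto simp: N_def complex_eq_iff)
  qed
  have "mat_adjoint W * W = 1\<^sub>m n"
  proof (rule eq_matI)
    fix i j assume "i < dim_row (1\<^sub>m n :: complex mat)" "j < dim_col (1\<^sub>m n :: complex mat)"
    then have ij: "i < n" "j < n" by auto
    have "(mat_adjoint W * W) $$ (i, j) = (\<Sum>k<n. ws ! j $ k * cnj (ws ! i $ k)) / (N i * N j)"
      using ij by (simp add: mat_mult_index W_def sum_divide_distrib mult_ac del: index_mult_mat(1))
    also have "(\<Sum>k<n. ws ! j $ k * cnj (ws ! i $ k)) = ws ! j \<bullet>c ws ! i"
      using carrier_vecD[OF wsc[OF ij(1)]] carrier_vecD[OF wsc[OF ij(2)]]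
      by (simp add: scalar_prod_def atLeast0LessThan)
    also have "\<dots> / (N i * N j) = (if i = j then 1 else 0)"
      using corthogonalD[OF ws(2), of j i] ws(3) ij sq[of i]
      by (auto simp: power2_eq_square)
    finally show "(mat_adjoint W * W) $$ (i, j) = 1\<^sub>m n $$ (i, j)" using ij by simp
  qed (auto simp: W_def)
  then have "unitary_mat n W" by (simp add: unitary_mat_def W_def)
  moreover have "col W 0 = (1 / N 0) \<cdot>\<^sub>v v"
    using n v hdws by (intro eq_vecI) (auto simp: W_def)
  ultimately show ?thesis by blast
qed

text \<open>
  The blocks have sizes 1 and \<open>n\<close>, as they arise when one eigenvector is split off.
\<close>

lemma mult_block_diagonal:
  fixes A B C D :: "'a :: semiring_1 mat"
  assumes "A \<in> carrier_mat 1 1" "B \<in> carrier_mat 1 1" "C \<in> carrier_mat n n" "D \<in> carrier_mat n n"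
  shows "four_block_mat A (0\<^sub>m 1 n) (0\<^sub>m n 1) C * four_block_mat B (0\<^sub>m 1 n) (0\<^sub>m n 1) D =
    four_block_mat (A * B) (0\<^sub>m 1 n) (0\<^sub>m n 1) (C * D)"
  by (subst mult_four_block_mat[of _ 1 1 _ n _ n _ _ 1 _ n])
    (use assms mult_carrier_mat[OF assms(1,2)] mult_carrier_mat[OF assms(3,4)] in auto)

text \<open>
  The spectral theorem, by splitting off one eigenvector at a time. The list \<open>es\<close> may be any ordering
  of the roots of the characteristic polynomial, so the order in which the eigenvalues appear on the
  diagonal can be prescribed.
\<close>

lemma hermitian_unitary_diagonalization:
  fixes A :: "complex mat"
  assumes "A \<in> carrier_mat n n" "mat_adjoint A = A"
    and "char_poly A = (\<Prod>e\<leftarrow>es. [:- e, 1:])"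
  shows "\<exists>U. unitary_mat n U \<and> A = U * mat_diag n (\<lambda>i. es ! i) * mat_adjoint U"
  using assms
proof (induction es arbitrary: n A)
  case Nil
  then have "n = 0" using degree_monic_char_poly[of A n] by simp
  then have "A = 1\<^sub>m n * mat_diag n (\<lambda>i. [] ! i) * mat_adjoint (1\<^sub>m n)"
    using Nil.prems by (intro eq_matI) auto
  then show ?case using unitary_mat_one by blast
next
  case (Cons e es n A)
  note A = Cons.prems(1)
  let ?q = "\<Prod>e\<leftarrow>es. [:- e, 1:]"
  have cp: "char_poly A = [:- e, 1:] * ?q" using Cons.prems(3) by simp
  have mon: "monic ?q" by (rule monic_prod_list) auto
  have "degree (char_poly A) = Suc (degree ?q)"
    unfolding cp by (subst degree_mult_eq) (use mon in auto)
  then have n: "n = Suc (degree ?q)" using degree_monic_char_poly[OF A] by simp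
  define n1 where "n1 = degree ?q"
  have n: "n = Suc n1" using n by (simp add: n1_def)
  have "eigenvalue A e" unfolding eigenvalue_root_char_poly[OF A] cp by simp
  then obtain v where v: "v \<in> carrier_vec n" "v \<noteq> 0\<^sub>v n" "A *\<^sub>v v = e \<cdot>\<^sub>v v"
    using A unfolding eigenvalue_def eigenvector_def by auto
  obtain W c where W: "unitary_mat n W" and W0: "col W 0 = c \<cdot>\<^sub>v v"
    using unitary_mat_with_first_column[OF v(1,2)] by blast
  note WD = unitary_matD[OF W]
  define A' where "A' = mat_adjoint W * A * W"
  have A': "A' \<in> carrier_mat n n" using WD A by (intro carrier_matI) (simp_all add: A'_def)
  have A'_eq: "A = W * A' * mat_adjoint W"
    using WD A by (simp add: A'_def mat_mult_assoc unitary_mat_cancel[OF W])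
  have herm: "mat_adjoint A' = A'"
    using WD A Cons.prems(2) by (simp add: A'_def mat_adjoint_mult mat_mult_assoc)
  have "col A' 0 = mat_adjoint W *\<^sub>v (A *\<^sub>v col W 0)"
    using WD A n col_mult2[of A n n W n 0] col_mult2[of "mat_adjoint W" n n "A * W" n 0]
    by (simp add: A'_def mat_mult_assoc)
  also have "A *\<^sub>v col W 0 = e \<cdot>\<^sub>v col W 0"
    using v A by (simp add: W0 mult_mat_vec[OF A] smult_smult_assoc mult.commute)
  also have "mat_adjoint W *\<^sub>v (e \<cdot>\<^sub>v col W 0) = e \<cdot>\<^sub>v (mat_adjoint W *\<^sub>v col W 0)"
    using WD n col_dim[of W 0] by (intro mult_mat_vec[of _ n n]) auto
  also have "mat_adjoint W *\<^sub>v col W 0 = col (mat_adjoint W * W) 0"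
    using WD n by (subst col_mult2[of _ n n _ n]) auto
  finally have col0: "col A' 0 = e \<cdot>\<^sub>v unit_vec n 0" using WD(4) n by simp
  \<comment> \<open>The first column of \<open>A'\<close> is a multiple of the first unit vector; since \<open>A'\<close> is Hermitian, so is its first row.\<close>
  have A'0: "A' $$ (i, 0) = (if i = 0 then e else 0)" if "i < n" for i
    using arg_cong[OF col0, of "\<lambda>w :: complex vec. w $ i"] that A' n by auto
  have A'0': "A' $$ (0, j) = (if j = 0 then e else 0)" if "j < n" for j
    using A'0[OF that] arg_cong[OF herm, of "\<lambda>M. M $$ (0, j)"]
      arg_cong[OF herm, of "\<lambda>M. M $$ (0, 0)"] that A' n by (auto split: if_splits)
  define A3 where "A3 = mat n1 n1 (\<lambda>(i, j). A' $$ (Suc i, Suc j))"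
  have A3: "A3 \<in> carrier_mat n1 n1" by (simp add: A3_def)
  define A1 :: "complex mat" where "A1 = mat 1 1 (\<lambda>_. e)"
  have A1: "A1 \<in> carrier_mat 1 1" by (simp add: A1_def)
  have block: "A' = four_block_mat A1 (0\<^sub>m 1 n1) (0\<^sub>m n1 1) A3"
    using A' n A'0 A'0' by (intro eq_matI) (auto simp: A1_def A3_def)
  have "mat_adjoint A3 = A3"
  proof (rule eq_matI)
    fix i j assume "i < dim_row A3" "j < dim_col A3"
    then show "mat_adjoint A3 $$ (i, j) = A3 $$ (i, j)"
      using arg_cong[OF herm, of "\<lambda>M. M $$ (Suc i, Suc j)"] A' n by (simp add: A3_def)
  qed (simp_all add: A3_def)
  moreover have "char_poly A3 = ?q"
  proof -
    have "similar_mat A' A"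
      using WD A unfolding similar_mat_def similar_mat_wit_def Let_def
      by (intro exI[of _ "mat_adjoint W"] exI[of _ W]) (auto simp: A'_def)
    from char_poly_similar[OF this] have "[:- e, 1:] * ?q = char_poly A'" by (simp add: cp)
    also have "\<dots> = char_poly A1 * char_poly A3"
      unfolding block by (rule char_poly_four_block_zeros_col[OF A1 _ A3]) simp
    also have "char_poly A1 = [:- e, 1:]"
      by (simp add: A1_def char_poly_defs det_def sign_def)
    finally show ?thesis by (metis mult_cancel_left pCons_eq_0_iff zero_neq_one)
  qed
  ultimately obtain U3 where U3: "unitary_mat n1 U3"
    and A3_eq: "A3 = U3 * mat_diag n1 (\<lambda>i. es ! i) * mat_adjoint U3"
    using Cons.IH[OF A3] by blast
  note UD = unitary_matD[OF U3]
  define V where "V = four_block_mat (1\<^sub>m 1) (0\<^sub>m 1 n1) (0\<^sub>m n1 1) U3"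
  have adjV: "mat_adjoint V = four_block_mat (1\<^sub>m 1) (0\<^sub>m 1 n1) (0\<^sub>m n1 1) (mat_adjoint U3)"
    using UD by (intro eq_matI) (auto simp: V_def)
  have dg: "mat_diag n (\<lambda>i. (e # es) ! i) =
      four_block_mat A1 (0\<^sub>m 1 n1) (0\<^sub>m n1 1) (mat_diag n1 (\<lambda>i. es ! i))"
    using n by (intro eq_matI) (auto simp: A1_def mat_diag_def)
  have V: "unitary_mat n V"
  proof -
    have "mat_adjoint V * V = four_block_mat (1\<^sub>m 1) (0\<^sub>m 1 n1) (0\<^sub>m n1 1) (1\<^sub>m n1)"
      unfolding adjV unfolding V_def using UD by (subst mult_block_diagonal) auto
    also have "\<dots> = 1\<^sub>m n" using n by (intro eq_matI) auto
    finally show ?thesis using UD n by (auto simp: unitary_mat_def V_def)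
  qed
  have UD_carrier: "U3 * mat_diag n1 (\<lambda>i. es ! i) \<in> carrier_mat n1 n1"
    using UD by (intro mult_carrier_mat[of _ _ n1]) auto
  have "V * mat_diag n (\<lambda>i. (e # es) ! i) * mat_adjoint V =
      four_block_mat (1\<^sub>m 1 * A1) (0\<^sub>m 1 n1) (0\<^sub>m n1 1) (U3 * mat_diag n1 (\<lambda>i. es ! i)) *
      four_block_mat (1\<^sub>m 1) (0\<^sub>m 1 n1) (0\<^sub>m n1 1) (mat_adjoint U3)"
    unfolding adjV dg unfolding V_def using UD A1 by (subst mult_block_diagonal) auto
  also have "\<dots> = four_block_mat (1\<^sub>m 1 * A1 * 1\<^sub>m 1) (0\<^sub>m 1 n1) (0\<^sub>m n1 1) A3"
    unfolding A3_eq using UD A1 UD_carrier by (intro mult_block_diagonal) auto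
  also have "\<dots> = A'" using A1 by (simp add: block)
  finally have "V * mat_diag n (\<lambda>i. (e # es) ! i) * mat_adjoint V = A'" .
  then have "A = W * (V * mat_diag n (\<lambda>i. (e # es) ! i) * mat_adjoint V) * mat_adjoint W"
    using A'_eq by simp
  also have "\<dots> = (W * V) * mat_diag n (\<lambda>i. (e # es) ! i) * mat_adjoint (W * V)"
    using WD unitary_matD[OF V] by (simp add: mat_adjoint_mult mat_mult_assoc mat_diag_def)
  finally show ?case using unitary_mat_mult[OF W V] by blast
qed

section \<open>Eigenvalues and singular values\<close>

text \<open>
  The eigenvalues of a positive semidefinite matrix of rank \<open>k\<close> in decreasing order, continued by
  zeros to an infinite sequence, so that sums up to the size of the matrix and sums up to its rank agree.
\<close>

definition decreasing_spectrum :: "nat \<Rightarrow> (nat \<Rightarrow> real) \<Rightarrow> bool" where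
  "decreasing_spectrum k d \<longleftrightarrow> antimono d \<and> (\<forall>i. 0 \<le> d i) \<and> (\<forall>i. 0 < d i \<longleftrightarrow> i < k)"

lemma decreasing_spectrum_zero: "decreasing_spectrum k d \<Longrightarrow> k \<le> i \<Longrightarrow> d i = 0"
  by (metis decreasing_spectrum_def leD order_le_less)

lemma sum_decreasing_spectrum:
  fixes f :: "nat \<Rightarrow> real"
  assumes "decreasing_spectrum k d" "k \<le> n" "\<And>i. d i = 0 \<Longrightarrow> f i = 0"
  shows "(\<Sum>i<n. f i) = (\<Sum>i<k. f i)"
  using assms(2,3) decreasing_spectrum_zero[OF assms(1)]
  by (intro sum.mono_neutral_right) auto

lemma positive_semidefinite_diagonalization:
  assumes H: "H \<in> carrier_mat n n" and psd: "positive_semidefinite H"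
  shows "\<exists>U k d. unitary_mat n U \<and> k \<le> n \<and> decreasing_spectrum k d \<and>
    H = U * real_diag n d * mat_adjoint U"
proof -
  have herm: "mat_adjoint H = H" using psd by (simp add: positive_semidefinite_def)
  obtain es where cp: "char_poly H = (\<Prod>e\<leftarrow>es. [:- e, 1:])" and len: "length es = n"
    using char_poly_factorized[OF H] by blast
  have real: "complex_of_real (Re e) = e" "0 \<le> Re e" if e: "e \<in> set es" for e
  proof -
    have "poly (char_poly H) e = 0" using e unfolding cp by (simp add: poly_prod_list prod_list_zero_iff)
    then have "eigenvalue H e" using eigenvalue_root_char_poly[OF H] by simp
    then obtain v where v: "v \<in> carrier_vec n" "v \<noteq> 0\<^sub>v n" "H *\<^sub>v v = e \<cdot>\<^sub>v v"
      using H unfolding eigenvalue_def eigenvector_def by auto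
    have "0 \<le> (H *\<^sub>v v) \<bullet>c v" using psd v H by (auto simp: positive_semidefinite_def)
    also have "\<dots> = e * (v \<bullet>c v)" using v by simp
    finally have "0 \<le> e * (v \<bullet>c v)" .
    moreover have "v \<bullet>c v > 0" using conjugate_square_greater_0_vec[OF v(1)] v(2) by simp
    ultimately have "0 \<le> e"
      by (auto simp: less_eq_complex_def less_complex_def zero_le_mult_iff complex_eq_iff)
    then show "complex_of_real (Re e) = e" "0 \<le> Re e"
      by (auto simp: less_eq_complex_def complex_eq_iff)
  qed
  \<comment> \<open>Sorting before diagonalizing saves permuting the columns of \<open>U\<close> afterwards.\<close>
  define ds where "ds = rev (sort (map Re es))"
  have ds: "set ds = Re ` set es" "length ds = n" by (auto simp: ds_def len)
  have "mset (map complex_of_real ds) = image_mset complex_of_real (image_mset Re (mset es))"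
    by (simp add: ds_def)
  also have "\<dots> = image_mset id (mset es)" using real(1)
    unfolding image_mset.compositionality o_def by (intro image_mset_cong) simp
  also have "\<dots> = mset es" by simp
  finally have "mset (map (\<lambda>e. [:- e, 1:]) (map complex_of_real ds)) = mset (map (\<lambda>e. [:- e, 1:]) es)"
    by (metis mset_map)
  then have cp': "char_poly H = (\<Prod>e\<leftarrow>map complex_of_real ds. [:- e, 1:])"
    unfolding cp by (metis prod_mset_prod_list)
  obtain U where U: "unitary_mat n U"
    and HU: "H = U * mat_diag n (\<lambda>i. map complex_of_real ds ! i) * mat_adjoint U"
    using hermitian_unitary_diagonalization[OF H herm cp'] by blast
  define d where "d i = (if i < n then ds ! i else 0)" for i
  have "mat_diag n (\<lambda>i. map complex_of_real ds ! i) = real_diag n d"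
    using ds(2) by (intro eq_matI) (auto simp: mat_diag_def d_def)
  with HU have HU: "H = U * real_diag n d * mat_adjoint U" by simp
  have nonneg: "0 \<le> d i" for i
    using real(2) ds nth_mem[of i ds] by (auto simp: d_def)
  have anti: "antimono d"
  proof (rule antimonoI)
    fix i j :: nat assume "i \<le> j"
    moreover have "sorted (rev ds)" by (simp add: ds_def)
    ultimately show "d j \<le> d i"
      using nonneg[of i] ds(2) sorted_rev_nth_mono[of ds i j] by (auto simp: d_def)
  qed
  define k where "k = (LEAST i. d i = 0)"
  have "d n = 0" by (simp add: d_def)
  then have k: "d k = 0" "k \<le> n" unfolding k_def by (rule LeastI, rule Least_le)
  have "0 < d i \<longleftrightarrow> i < k" for i
  proof
    assume "0 < d i"
    then show "i < k" using antimonoD[OF anti, of k i] k by (cases "k \<le> i") auto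
  next
    assume "i < k"
    then have "d i \<noteq> 0" unfolding k_def by (rule not_less_Least)
    then show "0 < d i" using nonneg[of i] by simp
  qed
  then have "decreasing_spectrum k d" using anti nonneg by (simp add: decreasing_spectrum_def)
  then show ?thesis using U HU k by blast
qed

lemma proots_prod_linear:
  fixes xs :: "'a :: idom list"
  shows "proots (\<Prod>a\<leftarrow>xs. [:- a, 1:]) = mset xs"
proof (induction xs)
  case (Cons a xs)
  have "(\<Prod>a\<leftarrow>xs. [:- a, 1:]) \<noteq> 0" by (auto simp: prod_list_zero_iff)
  then show ?case using Cons by (simp add: proots_mult del: mult_pCons_left)
qed simp

text \<open>
  Similar matrices have the same characteristic polynomial, so the roots are the \<open>(d i)\<^sup>2\<close>, \<open>i < n\<close>;
  those with \<open>i \<ge> k\<close> vanish, and the others already come in decreasing order.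
\<close>

lemma nonzero_singular_values_eq:
  assumes A: "A \<in> carrier_mat m n" and U: "unitary_mat n U"
    and AA: "mat_adjoint A * A = U * real_diag n (\<lambda>i. (d i)\<^sup>2) * mat_adjoint U"
    and d: "decreasing_spectrum k d" and k: "k \<le> n"
  shows "nonzero_singular_values A = map d [0..<k]"
proof -
  let ?D = "real_diag n (\<lambda>i. (d i)\<^sup>2)"
  have "similar_mat (mat_adjoint A * A) ?D"
    unfolding similar_mat_def similar_mat_wit_def Let_def
    using unitary_matD[OF U] A
    by (intro exI[of _ U] exI[of _ "mat_adjoint U"]) (auto simp: AA)
  then have "char_poly (mat_adjoint A * A) = char_poly ?D" by (rule char_poly_similar)
  also have "\<dots> = (\<Prod>a\<leftarrow>diag_mat ?D. [:- a, 1:])"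
    by (rule char_poly_upper_triangular[of _ n]) (auto simp: mat_diag_def)
  finally have "char_poly (mat_adjoint A * A) = (\<Prod>a\<leftarrow>diag_mat ?D. [:- a, 1:])" .
  moreover have "diag_mat ?D = map (\<lambda>i. complex_of_real ((d i)\<^sup>2)) [0..<n]"
    by (auto simp: diag_mat_def mat_diag_def)
  ultimately have "proots (char_poly (mat_adjoint A * A)) =
      mset (map (\<lambda>i. complex_of_real ((d i)\<^sup>2)) [0..<n])"
    by (simp only: proots_prod_linear)
  also have "[0..<n] = [0..<k] @ [k..<n]"
    using k by (metis le_add_diff_inverse upt_add_eq_append zero_le)
  finally have roots: "proots (char_poly (mat_adjoint A * A)) =
      image_mset (\<lambda>i. complex_of_real ((d i)\<^sup>2)) (mset [0..<k]) +
      image_mset (\<lambda>i. complex_of_real ((d i)\<^sup>2)) (mset [k..<n])" by simp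
  have pos: "0 < d i" if "i < k" for i using d that by (simp add: decreasing_spectrum_def)
  have "filter_mset (\<lambda>z. z \<noteq> 0) (proots (char_poly (mat_adjoint A * A))) =
      image_mset (\<lambda>i. complex_of_real ((d i)\<^sup>2)) (mset [0..<k])"
  proof -
    have "filter_mset (\<lambda>z. z \<noteq> 0) (image_mset (\<lambda>i. complex_of_real ((d i)\<^sup>2)) (mset [k..<n])) = {#}"
      using decreasing_spectrum_zero[OF d] by (auto simp: filter_mset_eq_mempty_iff)
    moreover have "filter_mset (\<lambda>z. z \<noteq> 0) (image_mset (\<lambda>i. complex_of_real ((d i)\<^sup>2)) (mset [0..<k])) =
        image_mset (\<lambda>i. complex_of_real ((d i)\<^sup>2)) (mset [0..<k])"
      using pos by (fastforce simp: filter_mset_eq_conv)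
    ultimately show ?thesis by (simp add: roots)
  qed
  then have "{# sqrt (Re z). z \<in># filter_mset (\<lambda>z. z \<noteq> 0) (proots (char_poly (mat_adjoint A * A))) #} =
      image_mset (\<lambda>i. sqrt ((d i)\<^sup>2)) (mset [0..<k])"
    by (simp add: image_mset.compositionality o_def)
  also have "\<dots> = mset (rev (map d [0..<k]))"
    using d by (simp add: decreasing_spectrum_def)
  finally have "nonzero_singular_values A = rev (sort (rev (map d [0..<k])))"
    by (simp only: nonzero_singular_values_def sorted_list_of_multiset_mset)
  moreover have "sorted (rev (map d [0..<k]))"
    unfolding sorted_rev_iff_nth_mono
  proof (intro allI impI)
    fix i j assume "i \<le> j" "j < length (map d [0..<k])"
    moreover have "antimono d" using d by (simp add: decreasing_spectrum_def)
    ultimately show "map d [0..<k] ! j \<le> map d [0..<k] ! i"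
      using antimonoD[of d i j] by simp
  qed
  ultimately show ?thesis by (simp add: sorted_sort_id)
qed

section \<open>Column space and rank\<close>

lemma col_space_mult_subset:
  fixes A :: "complex mat"
  assumes "A \<in> carrier_mat n p" "X \<in> carrier_mat p q"
  shows "vec_space.col_space n (A * X) \<subseteq> vec_space.col_space n A"
proof -
  interpret vec_space "TYPE(complex)" n .
  have AX: "A * X \<in> carrier_mat n q" using assms by simp
  show ?thesis
    using assms unfolding col_space_eq[OF AX] col_space_eq[OF assms(1)]
    by (auto intro!: bexI[of _ "X *\<^sub>v _"])
qed

lemma rank_eq_if_col_space_eq:
  fixes A B :: "complex mat"
  assumes "vec_space.col_space n A = vec_space.col_space n B"
  shows "vec_space.rank n A = vec_space.rank n B"
  using assms unfolding vec_space.rank_def vec_space.col_space_def by simp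

text \<open>
  The first \<open>k\<close> columns of the product are nonzero multiples of columns of \<open>U\<close> and the others are
  zero, so the former are a maximal independent set of columns.
\<close>

lemma rank_unitary_diag:
  assumes U: "unitary_mat n U"
    and d: "\<And>i. i < n \<Longrightarrow> d i \<noteq> 0 \<longleftrightarrow> i < k" and k: "k \<le> n"
  shows "vec_space.rank n (U * real_diag n d) = k"
proof -
  interpret vec_space "TYPE(complex)" n .
  note UD = unitary_matD[OF U]
  \<comment> \<open>Replacing the zero entries by ones makes the product invertible without changing its first \<open>k\<close> columns.\<close>
  define d' where "d' i = (if i < k then d i else 1)" for i
  define N where "N = U * real_diag n d'"
  let ?M = "U * real_diag n d"
  have M: "?M \<in> carrier_mat n n" and N: "N \<in> carrier_mat n n"
    using UD by (auto simp: N_def)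
  have Me: "?M = mat n n (\<lambda>(i, j). U $$ (i, j) * d j)" and Ne: "N = mat n n (\<lambda>(i, j). U $$ (i, j) * d' j)"
    unfolding N_def by (rule mat_diag_mult_right[OF UD(1)])+
  have "N * (real_diag n (\<lambda>i. 1 / d' i) * mat_adjoint U) =
      U * (real_diag n d' * real_diag n (\<lambda>i. 1 / d' i)) * mat_adjoint U"
    using UD by (simp add: N_def mat_mult_assoc del: mat_diag_diag)
  also have "real_diag n d' * real_diag n (\<lambda>i. 1 / d' i) = 1\<^sub>m n"
    unfolding mat_diag_diag using d k by (intro eq_matI) (auto simp: mat_diag_def d'_def)
  finally have inv: "N * (real_diag n (\<lambda>i. 1 / d' i) * mat_adjoint U) = 1\<^sub>m n" using UD by simp
  have "det N * det (real_diag n (\<lambda>i. 1 / d' i) * mat_adjoint U) = 1"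
    using UD N by (subst det_mult[symmetric, of _ n])
      (auto simp only: inv det_one mat_diag_dims index_mult_mat mat_adjoint_dim intro!: carrier_matI)
  then have "det N \<noteq> 0" by auto
  then have rank: "rank N = n" using det_rank_iff[OF N] by simp
  have dist: "distinct (cols N)" using non_distinct_low_rank[OF N] rank by auto
  have indep: "lin_indpt (set (cols N))" by (rule full_rank_lin_indpt[OF N rank dist])
  let ?S = "(\<lambda>i. col N i) ` {..<k}"
  have col_eq: "col ?M i = col N i" if "i < k" for i
    using that k UD by (intro eq_vecI) (auto simp: Me Ne d'_def)
  have col_0: "col ?M i = 0\<^sub>v n" if "\<not> i < k" "i < n" for i
    using that d[of i] UD by (intro eq_vecI) (auto simp: Me)
  have SN: "?S \<subseteq> set (cols N)" using k N by (auto simp: cols_def)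
  have SM: "?S \<subseteq> set (cols ?M)"
  proof
    fix x assume "x \<in> ?S"
    then obtain i where i: "i < k" "x = col N i" by auto
    then show "x \<in> set (cols ?M)"
      using k M col_eq[OF i(1)] by (auto simp: cols_def intro!: image_eqI[of _ _ i])
  qed
  have Mcols: "set (cols ?M) \<subseteq> insert (0\<^sub>v n) ?S"
  proof
    fix x assume "x \<in> set (cols ?M)"
    then obtain i where "i < n" "x = col ?M i" using M by (auto simp: cols_def)
    then show "x \<in> insert (0\<^sub>v n) ?S" using col_eq[of i] col_0[of i] by (cases "i < k") auto
  qed
  have Sind: "lin_indpt ?S" using subset_li_is_li[OF indep SN] .
  have "maximal ?S (\<lambda>T. T \<subseteq> set (cols ?M) \<and> lin_indpt T)"
    unfolding maximal_def
  proof (intro conjI allI impI SM Sind)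
    fix T assume T: "?S \<subseteq> T \<and> T \<subseteq> set (cols ?M) \<and> lin_indpt T"
    have "set (cols ?M) \<subseteq> carrier_vec n" using M cols_dim[of ?M] by (simp only: carrier_matD)
    then have "T \<subseteq> carrier_vec n" using T by blast
    moreover have "(UNIV :: complex set) \<noteq> {0}" by (metis UNIV_I singletonD zero_neq_one)
    ultimately have "0\<^sub>v n \<notin> T" using T zero_nin_lin_indpt[of T] by auto
    then show "T = ?S" using T Mcols by auto
  qed
  then have "rank ?M = card ?S" by (rule rank_card_indpt[OF M])
  also have "inj_on (\<lambda>i. col N i) {..<k}"
  proof (rule inj_onI)
    fix i j assume "i \<in> {..<k}" "j \<in> {..<k}" "col N i = col N j"
    then show "i = j" using dist k N by (auto simp: distinct_conv_nth) (metis cols_length cols_nth carrier_matD(2) order_less_le_trans)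
  qed
  then have "card ?S = k" by (simp add: card_image)
  finally show ?thesis .
qed

lemma rank_mult_unitary_right:
  fixes A :: "complex mat"
  assumes A: "A \<in> carrier_mat m n" and V: "unitary_mat n V"
  shows "vec_space.rank m (A * V) = vec_space.rank m A"
proof (rule rank_eq_if_col_space_eq)
  note VD = unitary_matD[OF V]
  have "A = A * V * mat_adjoint V" using A VD by (simp add: mat_mult_assoc)
  then show "vec_space.col_space m (A * V) = vec_space.col_space m A"
    using col_space_mult_subset[OF A VD(1)] col_space_mult_subset[of "A * V" m n "mat_adjoint V" n] A VD
    by auto
qed

section \<open>The Gram matrix of a polar decomposition\<close>

lemma cscalar_prod_mult_mat_vec:
  fixes A :: "complex mat"
  assumes "A \<in> carrier_mat m n" "x \<in> carrier_vec n" "y \<in> carrier_vec m"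
  shows "(A *\<^sub>v x) \<bullet>c y = x \<bullet>c (mat_adjoint A *\<^sub>v y)"
proof -
  have "(A *\<^sub>v x) \<bullet>c y = (\<Sum>i<m. \<Sum>j<n. A $$ (i, j) * x $ j * cnj (y $ i))"
    using assms by (auto simp: scalar_prod_def atLeast0LessThan sum_distrib_right)
  also have "\<dots> = (\<Sum>j<n. \<Sum>i<m. A $$ (i, j) * x $ j * cnj (y $ i))" by (rule sum.swap)
  also have "\<dots> = x \<bullet>c (mat_adjoint A *\<^sub>v y)"
    using assms by (auto simp: scalar_prod_def atLeast0LessThan sum_distrib_left mult_ac)
  finally show ?thesis .
qed

lemma cscalar_prod_mult_mat_vec':
  fixes A :: "complex mat"
  assumes "A \<in> carrier_mat m n" "x \<in> carrier_vec m" "y \<in> carrier_vec n"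
  shows "(mat_adjoint A *\<^sub>v x) \<bullet>c y = x \<bullet>c (A *\<^sub>v y)"
  using cscalar_prod_mult_mat_vec[of "mat_adjoint A" n m x y] assms by simp

lemma cscalar_prod_two_columns:
  fixes A :: "complex mat" and c :: complex
  assumes A: "A \<in> carrier_mat m n" and ij: "i < n" "j < n"
  defines "x \<equiv> unit_vec n i + c \<cdot>\<^sub>v unit_vec n j" and "M \<equiv> mat_adjoint A * A"
  shows "(A *\<^sub>v x) \<bullet>c (A *\<^sub>v x) =
    M $$ (i, i) + c * cnj c * M $$ (j, j) + c * M $$ (i, j) + cnj c * M $$ (j, i)"
proof -
  have x: "x \<in> carrier_vec n" by (simp add: x_def)
  have Ax: "A *\<^sub>v x = col A i + c \<cdot>\<^sub>v col A j"
    using A ij by (intro eq_vecI) (auto simp: x_def scalar_prod_add_distrib[of _ n])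
  have M: "M $$ (a, b) = (\<Sum>k<m. cnj (A $$ (k, a)) * A $$ (k, b))" if "a < n" "b < n" for a b
    using that A by (simp add: M_def mat_mult_index del: index_mult_mat(1))
  have "(A *\<^sub>v x) \<bullet>c (A *\<^sub>v x) =
     (\<Sum>k<m. (A $$ (k, i) + c * A $$ (k, j)) * cnj (A $$ (k, i) + c * A $$ (k, j)))"
    unfolding Ax using A ij by (auto simp: scalar_prod_def atLeast0LessThan)
  also have "\<dots> = M $$ (i, i) + c * cnj c * M $$ (j, j) + c * M $$ (i, j) + cnj c * M $$ (j, i)"
    unfolding M[OF ij(1) ij(1)] M[OF ij(1) ij(2)] M[OF ij(2) ij(1)] M[OF ij(2) ij(2)]
      sum_distrib_left sum.distrib[symmetric]
    by (intro sum.cong refl) (simp add: algebra_simps)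
  finally show ?thesis .
qed

text \<open>
  Polarization: the entries of the Gram matrix are determined by the values of the quadratic form at
  \<open>e\<^sub>i + c e\<^sub>j\<close> for \<open>c = 1, -1, \<i>, -\<i>\<close>.
\<close>

lemma gram_eq_if_norms_eq:
  fixes A B :: "complex mat"
  assumes A: "A \<in> carrier_mat m n" and B: "B \<in> carrier_mat p n"
    and eq: "\<And>x. x \<in> carrier_vec n \<Longrightarrow> (A *\<^sub>v x) \<bullet>c (A *\<^sub>v x) = (B *\<^sub>v x) \<bullet>c (B *\<^sub>v x)"
  shows "mat_adjoint A * A = mat_adjoint B * B"
proof (rule eq_matI)
  fix i j assume "i < dim_row (mat_adjoint B * B)" "j < dim_col (mat_adjoint B * B)"
  then have ij: "i < n" "j < n" using B by auto
  let ?M = "mat_adjoint A * A" and ?N = "mat_adjoint B * B"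
  have *: "?M $$ (i, i) + c * cnj c * ?M $$ (j, j) + c * ?M $$ (i, j) + cnj c * ?M $$ (j, i) =
      ?N $$ (i, i) + c * cnj c * ?N $$ (j, j) + c * ?N $$ (i, j) + cnj c * ?N $$ (j, i)" for c
    using eq[of "unit_vec n i + c \<cdot>\<^sub>v unit_vec n j"]
      cscalar_prod_two_columns[OF A ij, of c] cscalar_prod_two_columns[OF B ij, of c] by simp
  define a b a' b' s t where "a = ?M $$ (i, j)" "b = ?M $$ (j, i)" "a' = ?N $$ (i, j)" "b' = ?N $$ (j, i)"
    "s = ?M $$ (i, i) + ?M $$ (j, j)" "t = ?N $$ (i, i) + ?N $$ (j, j)"
  have "s + a + b = t + a' + b'" "s - a - b = t - a' - b'"
    "s + \<i> * a - \<i> * b = t + \<i> * a' - \<i> * b'" "s - \<i> * a + \<i> * b = t - \<i> * a' + \<i> * b'"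
    using *[of 1] *[of "-1"] *[of \<i>] *[of "- \<i>"]
    by (simp_all add: a_b_a'_b'_s_t_def)
  then have "a = a'" by (simp add: complex_eq_iff)
  then show "?M $$ (i, j) = ?N $$ (i, j)" by (simp add: a_b_a'_b'_s_t_def)
qed (use A B in auto)

text \<open>
  The range condition is what makes this true: \<open>H x\<close> lies in the range of \<open>Q\<^sup>*\<close>, that is, in the
  orthogonal complement of the kernel of \<open>Q\<close>, where \<open>Q\<close> is isometric. Hence \<open>A x\<close> and \<open>H x\<close>
  have the same length for every \<open>x\<close>.
\<close>

lemma gen_polar_decomposition_gram:
  assumes "gen_polar_decomposition m n A Q H"
  shows "mat_adjoint A * A = H * H"
proof -
  interpret vec_space "TYPE(complex)" n .
  from assms have Q: "Q \<in> carrier_mat m n" and H: "H \<in> carrier_mat n n" and A: "A = Q * H"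
    and sub: "subunitary Q" and herm: "mat_adjoint H = H"
    and range: "col_space (mat_adjoint Q) = col_space H"
    by (auto simp: gen_polar_decomposition_def positive_semidefinite_def)
  have QH: "Q * H \<in> carrier_mat m n" using Q H by simp
  have "(Q * H *\<^sub>v x) \<bullet>c (Q * H *\<^sub>v x) = (H *\<^sub>v x) \<bullet>c (H *\<^sub>v x)" if x: "x \<in> carrier_vec n" for x
  proof -
    have "H *\<^sub>v x \<in> col_space (mat_adjoint Q)"
      unfolding range col_space_eq[OF H] using H x by auto
    then obtain w where w: "w \<in> carrier_vec m" "mat_adjoint Q *\<^sub>v w = H *\<^sub>v x"
      using Q col_space_eq[of "mat_adjoint Q" m] by auto
    have "(H *\<^sub>v x) \<bullet>c z = 0" if "z \<in> mat_kernel Q" for z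
      using mat_kernelD[OF Q that] cscalar_prod_mult_mat_vec'[OF Q w(1), of z] w by simp
    then have "(Q *\<^sub>v (H *\<^sub>v x)) \<bullet>c (Q *\<^sub>v (H *\<^sub>v x)) = (H *\<^sub>v x) \<bullet>c (H *\<^sub>v x)"
      using sub Q H x by (auto simp: subunitary_def)
    then show ?thesis using Q H x by simp
  qed
  from gram_eq_if_norms_eq[OF QH H this] show ?thesis by (simp add: A herm)
qed

text \<open>
  All that the norm estimates use of a polar decomposition: the eigenvectors of \<open>H\<close> are right
  singular vectors of \<open>A\<close>, and its nonzero eigenvalues are the nonzero singular values of \<open>A\<close>.
\<close>

lemma gen_polar_decomposition_spectrum:
  assumes polar: "gen_polar_decomposition m n A Q H"
  shows "\<exists>U d. unitary_mat n U \<and> vec_space.rank m A \<le> n \<and> decreasing_spectrum (vec_space.rank m A) d \<and>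
    H = U * real_diag n d * mat_adjoint U \<and>
    mat_adjoint A * A = U * real_diag n (\<lambda>i. (d i)\<^sup>2) * mat_adjoint U \<and>
    nonzero_singular_values A = map d [0..<vec_space.rank m A]"
proof -
  from polar have A: "A \<in> carrier_mat m n" and H: "H \<in> carrier_mat n n"
    and psd: "positive_semidefinite H" and rank: "vec_space.rank n H = vec_space.rank m A"
    by (auto simp: gen_polar_decomposition_def)
  obtain U k d where U: "unitary_mat n U" and k: "k \<le> n" and d: "decreasing_spectrum k d"
    and HU: "H = U * real_diag n d * mat_adjoint U"
    using positive_semidefinite_diagonalization[OF H psd] by blast
  note UD = unitary_matD[OF U]
  have iff: "d i \<noteq> 0 \<longleftrightarrow> i < k" for i
    using d unfolding decreasing_spectrum_def by (metis order_less_le)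
  have "vec_space.rank n H = vec_space.rank n (U * real_diag n d)"
    unfolding HU using UD unitary_mat_adjoint[OF U] by (intro rank_mult_unitary_right) auto
  then have rk: "vec_space.rank m A = k" using rank_unitary_diag[OF U iff k] rank by simp
  have "mat_adjoint A * A = H * H" by (rule gen_polar_decomposition_gram[OF polar])
  also have "\<dots> = U * (real_diag n d * real_diag n d) * mat_adjoint U"
    unfolding HU using UD by (simp add: mat_mult_assoc unitary_mat_cancel[OF U] del: mat_diag_diag)
  finally have AA: "mat_adjoint A * A = U * real_diag n (\<lambda>i. (d i)\<^sup>2) * mat_adjoint U"
    by (simp add: power2_eq_square)
  show ?thesis
    unfolding rk using U k d HU AA nonzero_singular_values_eq[OF A U AA d k] by blast
qed

section \<open>The trace inequality\<close>

text \<open>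
  Bessel's inequality for the \<open>i\<close>-th column of \<open>X\<close> and the orthogonal columns of \<open>Y\<close>, which have
  length \<open>e j\<close>: subtracting from \<open>X\<close> its projection onto the span of these columns leaves a matrix
  \<open>W\<close>, and the diagonal of \<open>W\<^sup>* W\<close> is nonnegative. Columns of length zero are covered because
  division by zero yields zero, in the claim as in the coefficients of the projection.
\<close>

lemma bessel_inequality_gram:
  assumes X: "X \<in> carrier_mat m n" and Y: "Y \<in> carrier_mat m n"
    and YY: "mat_adjoint Y * Y = real_diag n (\<lambda>j. (e j)\<^sup>2)" and i: "i < n"
  shows "(\<Sum>j<n. (cmod ((mat_adjoint X * Y) $$ (i, j)))\<^sup>2 / (e j)\<^sup>2)
    \<le> Re ((mat_adjoint X * X) $$ (i, i))"
proof -
  define Z where "Z = mat_adjoint X * Y"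
  define T where "T = real_diag n (\<lambda>j. inverse ((e j)\<^sup>2))"
  \<comment> \<open>The coefficients of the projection of the columns of \<open>X\<close> onto those of \<open>Y\<close>.\<close>
  define C where "C = T * mat_adjoint Z"
  define W where "W = X - Y * C"
  note dims [simp] = carrier_matD[OF X] carrier_matD[OF Y]
  have Zd [simp]: "dim_row Z = n" "dim_col Z = n" by (simp_all add: Z_def)
  have Td [simp]: "dim_row T = n" "dim_col T = n" by (simp_all add: T_def)
  have Cd [simp]: "dim_row C = n" "dim_col C = n" by (simp_all add: C_def)
  have Wd [simp]: "dim_row W = m" "dim_col W = n" by (simp_all add: W_def)
  have T: "mat_adjoint T = T" unfolding T_def by (rule mat_adjoint_real_diag)
  have adjC: "mat_adjoint C = Z * T" by (simp add: C_def mat_adjoint_mult T)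
  have "T * (mat_adjoint Y * Y) * T = T"
    unfolding YY T_def by (simp, intro arg_cong[where f = "mat_diag n"] ext) (simp add: field_simps)
  then have TYT: "T * (mat_adjoint Y * (Y * (T * mat_adjoint Z))) = T * mat_adjoint Z"
    by (metis (no_types, lifting) mat_mult_assoc Td Zd dims mat_adjoint_dim index_mult_mat(2,3))
  have "mat_adjoint W * W = (mat_adjoint X - mat_adjoint C * mat_adjoint Y) * (X - Y * C)"
    by (simp add: W_def mat_adjoint_minus mat_adjoint_mult)
  also have "\<dots> = (mat_adjoint X * X - mat_adjoint C * mat_adjoint Y * X)
      - (mat_adjoint X * (Y * C) - mat_adjoint C * mat_adjoint Y * (Y * C))"
    by (simp add: mat_mult_minus_left mat_mult_minus_right)
  also have "mat_adjoint X * (Y * C) = Z * T * mat_adjoint Z"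
    by (simp add: C_def Z_def mat_mult_assoc)
  also have "mat_adjoint C * mat_adjoint Y * X = Z * T * mat_adjoint Z"
    unfolding adjC by (simp add: Z_def mat_mult_assoc mat_adjoint_mult)
  also have "mat_adjoint C * mat_adjoint Y * (Y * C) = Z * T * mat_adjoint Z"
    unfolding adjC using TYT by (simp add: C_def mat_mult_assoc)
  finally have "(mat_adjoint W * W) $$ (i, i) =
      (mat_adjoint X * X) $$ (i, i) - (Z * T * mat_adjoint Z) $$ (i, i)"
    using i by (simp del: index_mult_mat(1))
  moreover have "(Z * T * mat_adjoint Z) $$ (i, i) =
      complex_of_real (\<Sum>j<n. (cmod (Z $$ (i, j)))\<^sup>2 / (e j)\<^sup>2)"
  proof -
    have "Z * T = mat n n (\<lambda>(i, j). Z $$ (i, j) * complex_of_real (inverse ((e j)\<^sup>2)))"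
      unfolding T_def by (rule mat_diag_mult_right) (auto intro: carrier_matI)
    then have "(Z * T * mat_adjoint Z) $$ (i, i) =
        (\<Sum>j<n. Z $$ (i, j) * complex_of_real (inverse ((e j)\<^sup>2)) * cnj (Z $$ (i, j)))"
      using i by (simp add: mat_mult_index del: index_mult_mat(1))
    also have "\<dots> = (\<Sum>j<n. complex_of_real ((cmod (Z $$ (i, j)))\<^sup>2 / (e j)\<^sup>2))"
      by (intro sum.cong refl) (simp add: complex_norm_square divide_inverse del: of_real_power)
    finally show ?thesis by simp
  qed
  moreover have "0 \<le> Re ((mat_adjoint W * W) $$ (i, i))"
    using i by (simp add: mat_mult_index sum_nonneg del: index_mult_mat(1))
  ultimately show ?thesis by (simp add: Z_def)
qed

lemma gram_zero_column:
  fixes Y :: "complex mat"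
  assumes "Y \<in> carrier_mat m n" "j < n" "(mat_adjoint Y * Y) $$ (j, j) = 0" "k < m"
  shows "Y $$ (k, j) = 0"
proof -
  have "(\<Sum>k<m. (cmod (Y $$ (k, j)))\<^sup>2) = Re ((mat_adjoint Y * Y) $$ (j, j))"
    using assms(1,2) by (simp add: mat_mult_index cmod_power2 del: index_mult_mat(1) flip: power2_eq_square)
  then have "(\<Sum>k<m. (cmod (Y $$ (k, j)))\<^sup>2) = 0" using assms(3) by simp
  then show ?thesis using assms(4) by (simp add: sum_nonneg_eq_0_iff)
qed

text \<open>
  The Cauchy-Schwarz inequality for \<open>z p * \<mu> p = (\<surd>(w p) * (z p / w p)) * (\<surd>(w p) * \<mu> p)\<close>.
\<close>

lemma weighted_cauchy_schwarz:
  fixes w z \<mu> :: "'a \<Rightarrow> real"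
  assumes w: "\<And>p. p \<in> I \<Longrightarrow> 0 \<le> w p" and z: "\<And>p. p \<in> I \<Longrightarrow> w p = 0 \<Longrightarrow> z p = 0"
  shows "(\<Sum>p\<in>I. \<bar>z p\<bar> * \<bar>\<mu> p\<bar>)\<^sup>2 \<le> (\<Sum>p\<in>I. w p * (z p / w p)\<^sup>2) * (\<Sum>p\<in>I. w p * (\<mu> p)\<^sup>2)"
proof -
  let ?f = "\<lambda>p. sqrt (w p) * (z p / w p)" and ?g = "\<lambda>p. sqrt (w p) * \<mu> p"
  have "\<bar>z p\<bar> * \<bar>\<mu> p\<bar> = \<bar>?f p\<bar> * \<bar>?g p\<bar>" if p: "p \<in> I" for p
  proof (cases "w p = 0")
    case False
    then have "\<bar>?f p\<bar> * \<bar>?g p\<bar> = (sqrt (w p) * sqrt (w p)) * (\<bar>z p\<bar> / w p) * \<bar>\<mu> p\<bar>"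
      using w[OF p] by (simp add: abs_mult del: real_sqrt_mult_self)
    then show ?thesis using w[OF p] False by simp
  qed (use z[OF p] in simp)
  then have "(\<Sum>p\<in>I. \<bar>z p\<bar> * \<bar>\<mu> p\<bar>) \<le> L2_set ?f I * L2_set ?g I"
    using L2_set_mult_ineq[of ?f ?g I] by simp
  then have "(\<Sum>p\<in>I. \<bar>z p\<bar> * \<bar>\<mu> p\<bar>)\<^sup>2 \<le> (L2_set ?f I * L2_set ?g I)\<^sup>2"
    by (intro power_mono) (auto intro: sum_nonneg)
  also have "\<dots> = (\<Sum>p\<in>I. (?f p)\<^sup>2) * (\<Sum>p\<in>I. (?g p)\<^sup>2)"
    by (simp add: power_mult_distrib L2_set_def sum_nonneg)
  also have "(\<Sum>p\<in>I. (?f p)\<^sup>2) = (\<Sum>p\<in>I. w p * (z p / w p)\<^sup>2)"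
    using w by (intro sum.cong refl) (simp only: power_mult_distrib real_sqrt_pow2)
  also have "(\<Sum>p\<in>I. (?g p)\<^sup>2) = (\<Sum>p\<in>I. w p * (\<mu> p)\<^sup>2)"
    using w by (intro sum.cong refl) (simp only: power_mult_distrib real_sqrt_pow2)
  finally show ?thesis .
qed

lemma mat_trace_real_diag_sandwich:
  assumes M: "M \<in> carrier_mat n n"
  shows "mat_trace (mat_adjoint M * (real_diag n d * M * real_diag n e)) =
    complex_of_real (\<Sum>i<n. \<Sum>j<n. d i * e j * (cmod (M $$ (i, j)))\<^sup>2)"
proof -
  have "real_diag n d * M * real_diag n e = mat n n (\<lambda>(i, j). d i * M $$ (i, j) * e j)"
    by (subst mat_diag_mult_left[OF M], subst mat_diag_mult_right[of _ n]) auto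
  then show ?thesis using M
    by (simp add: mat_trace_adjoint_mult complex_norm_square mult_ac del: of_real_power)
qed

text \<open>
  The central estimate. The columns of \<open>X = A U\<close> and \<open>Y = B V\<close> are orthogonal with lengths
  \<open>d i\<close> and \<open>e j\<close>; with \<open>M = U\<^sup>* V\<close> and \<open>Z = X\<^sup>* Y\<close> both traces become sums over pairs,
  \<open>t = \<Sum>i j. d i * e j * |M i j|\<^sup>2\<close> and \<open>tr (A\<^sup>* B) = \<Sum>i j. cnj (M i j) * Z i j\<close>. The
  Cauchy-Schwarz inequality with the weights \<open>d i * e j\<close> splits off \<open>t\<close>; in the other factor
  stands \<open>S i j = (|Z i j| / (d i * e j))\<^sup>2\<close>, whose row and column sums are at most one by
  Bessel's inequality.
\<close>

lemma trace_cross_term_bound: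
  assumes A: "A \<in> carrier_mat m n" and B: "B \<in> carrier_mat m n"
    and U: "unitary_mat n U" and V: "unitary_mat n V"
    and AA: "mat_adjoint A * A = U * real_diag n (\<lambda>i. (d i)\<^sup>2) * mat_adjoint U"
    and BB: "mat_adjoint B * B = V * real_diag n (\<lambda>i. (e i)\<^sup>2) * mat_adjoint V"
    and d: "antimono d" "\<And>i. 0 \<le> d i" and e: "antimono e" "\<And>i. 0 \<le> e i"
  defines "t \<equiv> Re (mat_trace ((U * real_diag n d * mat_adjoint U) * (V * real_diag n e * mat_adjoint V)))"
  shows "(Re (mat_trace (mat_adjoint A * B)))\<^sup>2 \<le> (\<Sum>i<n. d i * e i) * t" "0 \<le> t"
proof -
  note UD = unitary_matD[OF U] and VD = unitary_matD[OF V]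
  note dims [simp] = UD(2,3) VD(2,3) carrier_matD[OF A] carrier_matD[OF B]
  define X where "X = A * U"
  define Y where "Y = B * V"
  define M where "M = mat_adjoint U * V"
  define Z where "Z = mat_adjoint X * Y"
  have M: "M \<in> carrier_mat n n" and X: "X \<in> carrier_mat m n" and Y: "Y \<in> carrier_mat m n"
    by (auto simp: M_def X_def Y_def intro!: carrier_matI)
  have Zd [simp]: "dim_row Z = n" "dim_col Z = n" by (simp_all add: Z_def X_def Y_def)
  have Md [simp]: "dim_row M = n" "dim_col M = n" by (simp_all add: M_def)
  have XX: "mat_adjoint X * X = real_diag n (\<lambda>i. (d i)\<^sup>2)"
  proof -
    have "mat_adjoint X * X = mat_adjoint U * (mat_adjoint A * A) * U"
      by (simp add: X_def mat_adjoint_mult mat_mult_assoc)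
    then show ?thesis
      unfolding AA by (simp add: mat_mult_assoc unitary_mat_cancel[OF U] UD(4) right_mult_one_mat')
  qed
  have YY: "mat_adjoint Y * Y = real_diag n (\<lambda>i. (e i)\<^sup>2)"
  proof -
    have "mat_adjoint Y * Y = mat_adjoint V * (mat_adjoint B * B) * V"
      by (simp add: Y_def mat_adjoint_mult mat_mult_assoc)
    then show ?thesis
      unfolding BB by (simp add: mat_mult_assoc unitary_mat_cancel[OF V] VD(4) right_mult_one_mat')
  qed
  have "mat_trace (mat_adjoint M * Z) = mat_trace (mat_adjoint V * (U * (mat_adjoint X * Y)))"
    by (simp add: M_def Z_def mat_adjoint_mult mat_mult_assoc X_def Y_def)
  also have "\<dots> = mat_trace ((U * (mat_adjoint X * Y)) * mat_adjoint V)"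
    by (rule mat_trace_mult_commute) (simp_all add: X_def Y_def)
  also have "(U * (mat_adjoint X * Y)) * mat_adjoint V = mat_adjoint A * B"
    by (simp add: X_def Y_def mat_adjoint_mult mat_mult_assoc unitary_mat_cancel[OF U] VD(5) right_mult_one_mat')
  finally have trAB: "mat_trace (mat_adjoint A * B) = (\<Sum>i<n. \<Sum>j<n. cnj (M $$ (i, j)) * Z $$ (i, j))"
    by (simp add: mat_trace_adjoint_mult)
  have "mat_trace (mat_adjoint M * (real_diag n d * M * real_diag n e)) =
      mat_trace (mat_adjoint V * (U * real_diag n d * mat_adjoint U * V * real_diag n e))"
    by (simp add: M_def mat_adjoint_mult mat_mult_assoc)
  also have "\<dots> = mat_trace (U * real_diag n d * mat_adjoint U * V * real_diag n e * mat_adjoint V)"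
    by (rule mat_trace_mult_commute) simp_all
  also have "\<dots> = mat_trace ((U * real_diag n d * mat_adjoint U) * (V * real_diag n e * mat_adjoint V))"
    by (simp add: mat_mult_assoc)
  finally have trHK: "mat_trace (mat_adjoint M * (real_diag n d * M * real_diag n e)) =
      mat_trace ((U * real_diag n d * mat_adjoint U) * (V * real_diag n e * mat_adjoint V))" .
  have t: "t = (\<Sum>i<n. \<Sum>j<n. d i * e j * (cmod (M $$ (i, j)))\<^sup>2)"
    using arg_cong[OF mat_trace_real_diag_sandwich[OF M, of d e, unfolded trHK], of Re]
    unfolding t_def by (simp only: Re_complex_of_real)
  show "0 \<le> t" unfolding t by (intro sum_nonneg mult_nonneg_nonneg d e) simp
  define z where "z i j = cmod (Z $$ (i, j))" for i j
  define S where "S i j = (z i j / (d i * e j))\<^sup>2" for i j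
  have row_le: "(\<Sum>j<n. (z i j)\<^sup>2 / (e j)\<^sup>2) \<le> (d i)\<^sup>2" if "i < n" for i
    using bessel_inequality_gram[OF X Y YY that] that
    by (simp add: XX z_def Z_def mat_diag_def del: index_mult_mat(1))
  have col_le: "(\<Sum>i<n. (z i j)\<^sup>2 / (d i)\<^sup>2) \<le> (e j)\<^sup>2" if j: "j < n" for j
  proof -
    have "cmod ((mat_adjoint Y * X) $$ (j, i)) = z i j" if "i < n" for i
    proof -
      have "mat_adjoint Y * X = mat_adjoint Z" by (simp add: Z_def mat_adjoint_mult X_def Y_def)
      then show ?thesis using that j by (simp add: z_def)
    qed
    then show ?thesis
      using bessel_inequality_gram[OF Y X XX j] j
      by (simp add: YY mat_diag_def del: index_mult_mat(1))
  qed
  have row: "(\<Sum>j<n. S i j) \<le> 1" if "i < n" for i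
  proof (cases "d i = 0")
    case False
    have "(\<Sum>j<n. S i j) = (\<Sum>j<n. (z i j)\<^sup>2 / (e j)\<^sup>2) / (d i)\<^sup>2"
      by (simp add: S_def power_divide power_mult_distrib sum_divide_distrib mult.commute)
    also have "\<dots> \<le> (d i)\<^sup>2 / (d i)\<^sup>2" using row_le[OF that] by (rule divide_right_mono) simp
    finally show ?thesis using False by simp
  qed (simp add: S_def)
  have col: "(\<Sum>i<n. S i j) \<le> 1" if "j < n" for j
  proof (cases "e j = 0")
    case False
    have "(\<Sum>i<n. S i j) = (\<Sum>i<n. (z i j)\<^sup>2 / (d i)\<^sup>2) / (e j)\<^sup>2"
      by (simp add: S_def power_divide power_mult_distrib sum_divide_distrib)
    also have "\<dots> \<le> (e j)\<^sup>2 / (e j)\<^sup>2" using col_le[OF that] by (rule divide_right_mono) simp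
    finally show ?thesis using False by simp
  qed (simp add: S_def)
  \<comment> \<open>A zero weight comes with a zero column of \<open>X\<close> or \<open>Y\<close>, so nothing is lost in the division.\<close>
  have zero: "z i j = 0" if ij: "i < n" "j < n" and "d i * e j = 0" for i j
  proof -
    have "Z $$ (i, j) = (\<Sum>k<m. cnj (X $$ (k, i)) * Y $$ (k, j))"
      using ij X Y by (simp add: Z_def mat_mult_index del: index_mult_mat(1))
    moreover have "X $$ (k, i) = 0 \<or> Y $$ (k, j) = 0" if "k < m" for k
      using gram_zero_column[OF X ij(1) _ that] gram_zero_column[OF Y ij(2) _ that] ij \<open>d i * e j = 0\<close>
      by (auto simp: XX YY mat_diag_def simp del: index_mult_mat(1))
    ultimately show ?thesis unfolding z_def by (auto intro!: sum.neutral)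
  qed
  let ?I = "{..<n} \<times> {..<n}"
  have "\<bar>Re (mat_trace (mat_adjoint A * B))\<bar> \<le> cmod (mat_trace (mat_adjoint A * B))"
    by (rule abs_Re_le_cmod)
  also have "\<dots> \<le> (\<Sum>i<n. \<Sum>j<n. z i j * cmod (M $$ (i, j)))"
    unfolding trAB by (intro sum_norm_le) (simp add: z_def norm_mult mult.commute)
  also have "\<dots> = (\<Sum>p\<in>?I. \<bar>z (fst p) (snd p)\<bar> * \<bar>cmod (M $$ p)\<bar>)"
    by (simp add: sum.cartesian_product z_def case_prod_unfold)
  finally have "\<bar>Re (mat_trace (mat_adjoint A * B))\<bar>\<^sup>2 \<le> (\<Sum>p\<in>?I. \<bar>z (fst p) (snd p)\<bar> * \<bar>cmod (M $$ p)\<bar>)\<^sup>2"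
    by (rule power_mono) simp
  also have "\<dots> \<le> (\<Sum>p\<in>?I. d (fst p) * e (snd p) * (z (fst p) (snd p) / (d (fst p) * e (snd p)))\<^sup>2) *
      (\<Sum>p\<in>?I. d (fst p) * e (snd p) * (cmod (M $$ p))\<^sup>2)"
    using zero d(2) e(2) by (intro weighted_cauchy_schwarz) auto
  also have "\<dots> = (\<Sum>i<n. \<Sum>j<n. d i * e j * S i j) * t"
    by (simp add: t S_def sum.cartesian_product case_prod_unfold)
  also have "\<dots> \<le> (\<Sum>i<n. d i * e i) * t"
    using row col \<open>0 \<le> t\<close> by (intro mult_right_mono substochastic_sum_le d e) (auto simp: S_def)
  finally show "(Re (mat_trace (mat_adjoint A * B)))\<^sup>2 \<le> (\<Sum>i<n. d i * e i) * t" by simp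
qed

section \<open>The norm bound\<close>

text \<open>
  The denominator of the coefficient is the positive root \<open>\<delta>\<close> of \<open>\<delta>\<^sup>2 + 2 F \<delta> = 2 G F\<close>; this equation
  replaces the square roots in all later computations.
\<close>

lemma polar_gap:
  fixes F G :: real
  assumes F: "0 < F" and G: "0 < G"
  defines "\<delta> \<equiv> sqrt (F\<^sup>2 + 2 * G * F) - F"
  shows "0 < \<delta>" "\<delta>\<^sup>2 + 2 * F * \<delta> = 2 * G * F" "\<delta> \<le> G"
proof -
  have "sqrt (F\<^sup>2) < sqrt (F\<^sup>2 + 2 * G * F)" using F G by (intro real_sqrt_less_mono) simp
  then show pos: "0 < \<delta>" using F by (simp add: \<delta>_def)
  have "(\<delta> + F)\<^sup>2 = F\<^sup>2 + 2 * G * F" using F G by (simp add: \<delta>_def)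
  then show eq: "\<delta>\<^sup>2 + 2 * F * \<delta> = 2 * G * F" by (simp add: power2_eq_square algebra_simps)
  have "\<delta> * (2 * F) \<le> G * (2 * F)" using eq zero_le_power2[of \<delta>] by (simp only: algebra_simps)
  then show "\<delta> \<le> G" using F by simp
qed

text \<open>
  The quotient \<open>(F + 2 \<surd>(G t)) / (F + 2 t)\<close> is largest at \<open>t = \<delta>\<^sup>2 / (4 G)\<close>, where it equals
  \<open>G / \<delta>\<close>. After clearing denominators the claim is \<open>(2 G t - \<delta>\<^sup>2 / 2)\<^sup>2 \<ge> 0\<close>.
\<close>

lemma ratio_le_polar_coefficient:
  fixes F G t u :: real
  assumes F: "0 < F" and G: "0 < G" and u: "u\<^sup>2 \<le> G * t" and t: "0 \<le> t"
  shows "F + 2 * u \<le> G / (sqrt (F\<^sup>2 + 2 * G * F) - F) * (F + 2 * t)"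
proof -
  define \<delta> where "\<delta> = sqrt (F\<^sup>2 + 2 * G * F) - F"
  note gap = polar_gap[OF F G, folded \<delta>_def]
  \<comment> \<open>By the equation for \<open>\<delta>\<close> it suffices that \<open>2 u \<delta> \<le> 2 G t + \<delta>\<^sup>2 / 2\<close>.\<close>
  have "(2 * u * \<delta>)\<^sup>2 \<le> 4 * (G * t) * \<delta>\<^sup>2"
    using mult_right_mono[OF u, of "4 * \<delta>\<^sup>2"] by (simp add: power_mult_distrib algebra_simps)
  also have "\<dots> \<le> (2 * G * t + \<delta>\<^sup>2 / 2)\<^sup>2"
    using zero_le_power2[of "2 * G * t - \<delta>\<^sup>2 / 2"] by (simp add: power2_eq_square algebra_simps)
  finally have "2 * u * \<delta> \<le> 2 * G * t + \<delta>\<^sup>2 / 2"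
    using G t by (intro power2_le_imp_le[of "2 * u * \<delta>"]) simp_all
  then have "(F + 2 * u) * \<delta> \<le> G * (F + 2 * t)" using gap(2) by (simp add: algebra_simps)
  then show ?thesis using gap(1) unfolding \<delta>_def[symmetric] by (simp add: field_simps)
qed

lemma gen_polar_decomposition_norms:
  assumes polar: "gen_polar_decomposition m n A Q H"
  shows "(frobenius_norm A)\<^sup>2 = (\<Sum>j<vec_space.rank m A. (nonzero_singular_values A ! j)\<^sup>2)"
    and "(frobenius_norm H)\<^sup>2 = (\<Sum>j<vec_space.rank m A. (nonzero_singular_values A ! j)\<^sup>2)"
proof -
  let ?r = "vec_space.rank m A"
  obtain U d where U: "unitary_mat n U" and r: "?r \<le> n" and d: "decreasing_spectrum ?r d"
    and AA: "mat_adjoint A * A = U * real_diag n (\<lambda>i. (d i)\<^sup>2) * mat_adjoint U"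
    and nsv: "nonzero_singular_values A = map d [0..<?r]"
    using gen_polar_decomposition_spectrum[OF polar] by blast
  note UD = unitary_matD[OF U]
  have "mat_trace (mat_adjoint A * A) = mat_trace (mat_adjoint U * (U * real_diag n (\<lambda>i. (d i)\<^sup>2)))"
    unfolding AA by (rule mat_trace_mult_commute) (simp_all add: UD)
  also have "\<dots> = mat_trace (real_diag n (\<lambda>i. (d i)\<^sup>2))"
    by (subst unitary_mat_cancel[OF U]) simp_all
  also have "\<dots> = complex_of_real (\<Sum>i<n. (d i)\<^sup>2)"
    by (simp add: mat_trace_def mat_diag_def)
  also have "(\<Sum>i<n. (d i)\<^sup>2) = (\<Sum>i<?r. (d i)\<^sup>2)"
    by (rule sum_decreasing_spectrum[OF d r]) simp
  finally show A: "(frobenius_norm A)\<^sup>2 = (\<Sum>j<?r. (nonzero_singular_values A ! j)\<^sup>2)"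
    by (simp add: frobenius_norm_sq nsv)
  have "mat_adjoint H = H" using polar by (simp add: gen_polar_decomposition_def positive_semidefinite_def)
  then have "(frobenius_norm H)\<^sup>2 = (frobenius_norm A)\<^sup>2"
    by (simp add: frobenius_norm_sq gen_polar_decomposition_gram[OF polar])
  with A show "(frobenius_norm H)\<^sup>2 = (\<Sum>j<?r. (nonzero_singular_values A ! j)\<^sup>2)" by simp
qed

text \<open>
  The squared norms share the part \<open>F\<close>, because \<open>A\<close> and \<open>H\<close> have the same norm, so only the cross terms
  differ.
\<close>

lemma gen_polar_decomposition_norms_add:
  assumes A: "gen_polar_decomposition m n A Q H" and B: "gen_polar_decomposition m n B P K"
  defines "F \<equiv> F_sum (vec_space.rank m A) (vec_space.rank m B) A B"
  shows "(frobenius_norm (A + B))\<^sup>2 = F + 2 * Re (mat_trace (mat_adjoint A * B))"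
    and "(frobenius_norm (H + K))\<^sup>2 = F + 2 * Re (mat_trace (H * K))"
proof -
  have carrier: "A \<in> carrier_mat m n" "B \<in> carrier_mat m n" "H \<in> carrier_mat n n" "K \<in> carrier_mat n n"
    and herm: "mat_adjoint H = H"
    using A B by (auto simp: gen_polar_decomposition_def positive_semidefinite_def)
  show "(frobenius_norm (A + B))\<^sup>2 = F + 2 * Re (mat_trace (mat_adjoint A * B))"
    by (simp add: frobenius_norm_add_sq[OF carrier(1,2)] F_def F_sum_def
        gen_polar_decomposition_norms(1)[OF A] gen_polar_decomposition_norms(1)[OF B])
  show "(frobenius_norm (H + K))\<^sup>2 = F + 2 * Re (mat_trace (H * K))"
    by (simp add: frobenius_norm_add_sq[OF carrier(3,4)] F_def F_sum_def herm
        gen_polar_decomposition_norms(2)[OF A] gen_polar_decomposition_norms(2)[OF B])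
qed

lemma F_sum_G_sum_decreasing_spectrum:
  assumes d: "decreasing_spectrum r d" and e: "decreasing_spectrum s e" and rs: "1 \<le> r" "r \<le> s"
    and nsv: "nonzero_singular_values A = map d [0..<r]" "nonzero_singular_values B = map e [0..<s]"
  shows "0 < F_sum r s A B" "0 < G_sum r A B" "r \<le> n \<Longrightarrow> G_sum r A B = (\<Sum>i<n. d i * e i)"
proof -
  have pos: "0 < d i" "0 < e i" if "i < r" for i
    using d e that rs by (auto simp: decreasing_spectrum_def)
  have G: "G_sum r A B = (\<Sum>i<r. d i * e i)"
    using rs by (auto simp: G_sum_def nsv intro!: sum.cong)
  show "0 < G_sum r A B" unfolding G using pos rs by (intro sum_pos) (auto simp: lessThan_empty_iff)
  have "0 < (nonzero_singular_values A ! j)\<^sup>2" if "j < r" for j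
    using pos(1)[OF that] that by (simp add: nsv)
  then have "0 < (\<Sum>j<r. (nonzero_singular_values A ! j)\<^sup>2)"
    using rs by (intro sum_pos) (auto simp: lessThan_empty_iff)
  then show "0 < F_sum r s A B"
    unfolding F_sum_def by (intro add_pos_nonneg sum_nonneg) auto
  show "G_sum r A B = (\<Sum>i<n. d i * e i)" if "r \<le> n"
    unfolding G using that by (intro sum_decreasing_spectrum[OF d, symmetric]) auto
qed

lemma frobenius_norm_add_le_polar_coefficient:
  assumes A: "gen_polar_decomposition m n A Q H" and B: "gen_polar_decomposition m n B P K"
    and ranks: "vec_space.rank m A = r" "vec_space.rank m B = s" and rs: "1 \<le> r" "r \<le> s"
  shows "frobenius_norm (A + B) \<le> polar_coefficient r s A B * frobenius_norm (H + K)"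
proof -
  define F where "F = F_sum r s A B"
  define G where "G = G_sum r A B"
  define u where "u = Re (mat_trace (mat_adjoint A * B))"
  define t where "t = Re (mat_trace (H * K))"
  obtain U d where U: "unitary_mat n U" and r: "r \<le> n" and d: "decreasing_spectrum r d"
    and H: "H = U * real_diag n d * mat_adjoint U"
    and AA: "mat_adjoint A * A = U * real_diag n (\<lambda>i. (d i)\<^sup>2) * mat_adjoint U"
    and nsvA: "nonzero_singular_values A = map d [0..<r]"
    using gen_polar_decomposition_spectrum[OF A, unfolded ranks] by blast
  obtain V e where V: "unitary_mat n V" and e: "decreasing_spectrum s e"
    and K: "K = V * real_diag n e * mat_adjoint V"
    and BB: "mat_adjoint B * B = V * real_diag n (\<lambda>i. (e i)\<^sup>2) * mat_adjoint V"
    and nsvB: "nonzero_singular_values B = map e [0..<s]"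
    using gen_polar_decomposition_spectrum[OF B, unfolded ranks] by blast
  note FG = F_sum_G_sum_decreasing_spectrum[OF d e rs nsvA nsvB]
  have carrier: "A \<in> carrier_mat m n" "B \<in> carrier_mat m n"
    using A B by (auto simp: gen_polar_decomposition_def)
  have spec: "antimono d" "\<And>i. 0 \<le> d i" "antimono e" "\<And>i. 0 \<le> e i"
    using d e by (auto simp: decreasing_spectrum_def)
  have ut: "u\<^sup>2 \<le> G * t" "0 \<le> t"
    using trace_cross_term_bound[OF carrier U V AA BB spec]
    by (simp_all add: u_def t_def G_def FG(3)[OF r] H K)
  have coeff: "0 \<le> G / (sqrt (F\<^sup>2 + 2 * G * F) - F)"
    using polar_gap(1)[OF FG(1,2)] FG(2) by (simp add: F_def G_def)
  have "(frobenius_norm (A + B))\<^sup>2 = F + 2 * u"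
    using gen_polar_decomposition_norms_add(1)[OF A B] by (simp add: ranks F_def u_def)
  also have "\<dots> \<le> G / (sqrt (F\<^sup>2 + 2 * G * F) - F) * (F + 2 * t)"
    using ut FG(1,2) by (intro ratio_le_polar_coefficient) (simp_all add: F_def G_def)
  also have "\<dots> = (polar_coefficient r s A B * frobenius_norm (H + K))\<^sup>2"
    using gen_polar_decomposition_norms_add(2)[OF A B] coeff
    by (simp add: ranks F_def G_def t_def polar_coefficient_def power_mult_distrib)
  finally show ?thesis
    using coeff by (rule_tac power2_le_imp_le)
      (auto simp: polar_coefficient_def F_def G_def frobenius_norm_nonneg)
qed

section \<open>Sharpness of the coefficient\<close>

text \<open>
  The difference \<open>x - P\<^sup>* P x\<close> lies in the kernel of \<open>P\<close>, so a vector \<open>x\<close> orthogonal to the kernel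
  satisfies \<open>\<langle>x, x\<rangle> = \<langle>x, P\<^sup>* P x\<rangle>\<close>.
\<close>

lemma subunitary_if_mult_adjoint:
  fixes P :: "complex mat"
  assumes "P * mat_adjoint P * P = P"
  shows "subunitary P"
  unfolding subunitary_def
proof (intro ballI impI)
  fix x assume x: "x \<in> carrier_vec (dim_col P)" and orth: "\<forall>z\<in>mat_kernel P. x \<bullet>c z = 0"
  have P: "P \<in> carrier_mat (dim_row P) (dim_col P)" by simp
  define w where "w = mat_adjoint P *\<^sub>v (P *\<^sub>v x)"
  have w: "w \<in> carrier_vec (dim_col P)" by (auto simp: w_def intro!: carrier_vecI)
  have Px: "P *\<^sub>v x \<in> carrier_vec (dim_row P)" by (intro carrier_vecI) simp
  have "(P * mat_adjoint P * P) *\<^sub>v x = (P * mat_adjoint P) *\<^sub>v (P *\<^sub>v x)"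
    using P x by (intro assoc_mult_mat_vec[of _ _ "dim_row P"]) (auto intro!: carrier_matI)
  also have "\<dots> = P *\<^sub>v w"
    unfolding w_def using P Px by (intro assoc_mult_mat_vec) auto
  finally have "P *\<^sub>v w = (P * mat_adjoint P * P) *\<^sub>v x" by simp
  then have "P *\<^sub>v (x - w) = 0\<^sub>v (dim_row P)"
    using mult_minus_distrib_mat_vec[OF P x w] assms by (intro eq_vecI) simp_all
  then have "x - w \<in> mat_kernel P" using x w by (intro mat_kernelI[OF P]) auto
  then have "x \<bullet>c (x - w) = 0" using orth by blast
  moreover have "x \<bullet>c (x - w) = x \<bullet>c x - x \<bullet>c w"
    using x w by (auto simp: scalar_prod_def sum_subtractf[symmetric] algebra_simps)
  moreover have "(P *\<^sub>v x) \<bullet>c (P *\<^sub>v x) = x \<bullet>c w"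
    unfolding w_def by (rule cscalar_prod_mult_mat_vec[OF P x Px])
  ultimately show "(P *\<^sub>v x) \<bullet>c (P *\<^sub>v x) = x \<bullet>c x" by (metis eq_iff_diff_eq_0)
qed

text \<open>
  A supply of matrices with prescribed singular values whose polar factors are explicit; \<open>J\<close> is the
  projection onto the range of \<open>D\<close>.
\<close>

lemma gen_polar_decomposition_diag_unitary:
  assumes V: "unitary_mat n V" and d: "decreasing_spectrum k d" and k: "k \<le> n"
  defines "D \<equiv> real_diag n d" and "J \<equiv> real_diag n (\<lambda>i. if i < k then 1 else 0)"
  shows "gen_polar_decomposition n n (D * V) (J * V) (mat_adjoint V * D * V)"
    and "vec_space.rank n (D * V) = k"
    and "nonzero_singular_values (D * V) = map d [0..<k]"
proof -
  note VD [simp] = unitary_matD[OF V]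
  note V' = unitary_mat_adjoint[OF V]
  have Dd [simp]: "dim_row D = n" "dim_col D = n" "dim_row J = n" "dim_col J = n"
    by (simp_all add: D_def J_def)
  have adj [simp]: "mat_adjoint D = D" "mat_adjoint J = J"
    unfolding D_def J_def by (rule mat_adjoint_real_diag)+
  have nz: "d i \<noteq> 0 \<longleftrightarrow> i < k" for i
    using d unfolding decreasing_spectrum_def by (metis order_less_le)
  \<comment> \<open>The pseudoinverse of \<open>D\<close>, since the inverse of zero is zero.\<close>
  define D' where "D' = real_diag n (\<lambda>i. inverse (d i))"
  have D'd [simp]: "dim_row D' = n" "dim_col D' = n" by (simp_all add: D'_def)
  have zero: "d i = 0 \<longleftrightarrow> \<not> i < k" for i using nz[of i] by blast
  have JD: "J * D = D" unfolding D_def J_def mat_diag_diag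
    by (rule arg_cong[where f = "mat_diag n"], rule ext) (simp add: zero)
  have JJ: "J * J = J" unfolding J_def mat_diag_diag
    by (rule arg_cong[where f = "mat_diag n"], rule ext) simp
  have DD': "D * D' = J" unfolding D_def D'_def J_def mat_diag_diag
    by (rule arg_cong[where f = "mat_diag n"], rule ext) (simp add: zero)
  have car [intro, simp]: "X \<in> carrier_mat n n" if "dim_row X = n" "dim_col X = n" for X :: "complex mat"
    using that by auto
  have rankD: "vec_space.rank n (U * D * W) = k" and rankJ: "vec_space.rank n (U * J * W) = k"
    if "unitary_mat n U" "unitary_mat n W" for U W
  proof -
    note UD = unitary_matD[OF that(1)]
    show "vec_space.rank n (U * D * W) = k"
      using rank_mult_unitary_right[OF _ that(2), of "U * D" n] rank_unitary_diag[OF that(1) nz k] UD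
      by (simp add: D_def)
    have "vec_space.rank n (U * J) = k"
      unfolding J_def using that(1) k by (intro rank_unitary_diag) auto
    then show "vec_space.rank n (U * J * W) = k"
      using rank_mult_unitary_right[OF _ that(2), of "U * J" n] UD by simp
  qed
  show rank: "vec_space.rank n (D * V) = k"
    using rankD[OF unitary_mat_one V] by simp
  have gram: "mat_adjoint (D * V) * (D * V) = mat_adjoint V * real_diag n (\<lambda>i. (d i)\<^sup>2) * mat_adjoint (mat_adjoint V)"
  proof -
    have "mat_adjoint (D * V) * (D * V) = mat_adjoint V * (D * D) * V"
      by (simp add: mat_adjoint_mult mat_mult_assoc)
    also have "D * D = real_diag n (\<lambda>i. (d i)\<^sup>2)" by (simp add: D_def power2_eq_square)
    finally show ?thesis by simp
  qed
  show "nonzero_singular_values (D * V) = map d [0..<k]"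
    by (rule nonzero_singular_values_eq[OF _ V' gram d k, of n]) simp
  let ?H = "mat_adjoint V * D * V"
  have "subunitary (J * V)"
  proof (rule subunitary_if_mult_adjoint)
    have "J * V * mat_adjoint (J * V) * (J * V) = J * (J * (J * V))"
      by (simp add: mat_adjoint_mult mat_mult_assoc unitary_mat_cancel[OF V])
    also have "\<dots> = J * V" using JJ by (simp flip: mat_mult_assoc)
    finally show "J * V * mat_adjoint (J * V) * (J * V) = J * V" .
  qed
  moreover have "positive_semidefinite ?H"
    unfolding positive_semidefinite_def
  proof (intro conjI ballI)
    show "mat_adjoint ?H = ?H" by (simp add: mat_adjoint_mult mat_mult_assoc)
    fix x :: "complex vec" assume "x \<in> carrier_vec (dim_col ?H)"
    then have x: "x \<in> carrier_vec n" by simp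
    define y where "y = V *\<^sub>v x"
    have y: "y \<in> carrier_vec n" by (auto simp: y_def intro!: carrier_vecI)
    have Dy: "D *\<^sub>v y \<in> carrier_vec n" by (intro carrier_vecI) simp
    have "?H *\<^sub>v x = (mat_adjoint V * D) *\<^sub>v y"
      unfolding y_def using x by (intro assoc_mult_mat_vec[of _ n n _ n]) simp_all
    also have "\<dots> = mat_adjoint V *\<^sub>v (D *\<^sub>v y)"
      using y by (intro assoc_mult_mat_vec[of _ n n _ n]) simp_all
    finally have "(?H *\<^sub>v x) \<bullet>c x = (D *\<^sub>v y) \<bullet>c y"
      using cscalar_prod_mult_mat_vec'[OF VD(1) Dy x] by (simp only: y_def)
    also have "\<dots> = (\<Sum>i<n. complex_of_real (d i * (cmod (y $ i))\<^sup>2))"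
    proof -
      have "(D *\<^sub>v y) $ i = complex_of_real (d i) * y $ i" if "i < n" for i
        using that y by (simp add: D_def mat_diag_def scalar_prod_def sum.remove[of _ i])
      then show ?thesis using y
        by (simp add: scalar_prod_def atLeast0LessThan complex_norm_square mult.assoc del: of_real_power)
    qed
    also have "\<dots> \<ge> 0"
      using d by (intro sum_nonneg) (simp add: less_eq_complex_def decreasing_spectrum_def)
    finally show "0 \<le> (?H *\<^sub>v x) \<bullet>c x" .
  qed simp
  moreover have "J * V * ?H = D * V"
    using JD by (simp add: mat_mult_assoc unitary_mat_cancel[OF V] flip: mat_mult_assoc[of J D V])
  moreover have "vec_space.col_space n (mat_adjoint (J * V)) = vec_space.col_space n ?H"
  proof
    have "?H = mat_adjoint (J * V) * (D * V)"
      using JD by (simp add: mat_adjoint_mult mat_mult_assoc flip: mat_mult_assoc[of J D V])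
    then show "vec_space.col_space n ?H \<subseteq> vec_space.col_space n (mat_adjoint (J * V))"
      using col_space_mult_subset[of "mat_adjoint (J * V)" n n "D * V" n] by simp
    have "mat_adjoint (J * V) = ?H * (mat_adjoint V * D')"
      using DD' by (simp add: mat_adjoint_mult mat_mult_assoc unitary_mat_cancel[OF V])
    then show "vec_space.col_space n (mat_adjoint (J * V)) \<subseteq> vec_space.col_space n ?H"
      using col_space_mult_subset[of ?H n n "mat_adjoint V * D'" n] by simp
  qed
  ultimately show "gen_polar_decomposition n n (D * V) (J * V) ?H"
    using rank rankJ[OF unitary_mat_one V] rankD[OF V' V]
    by (simp add: gen_polar_decomposition_def)
qed

text \<open>
  In each of the planes spanned by the basis vectors \<open>i\<close> and \<open>s + i\<close> this matrix is the reflection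
  with first column \<open>(c, w)\<close>. Being Hermitian, it is its own adjoint, and its square is the identity.
\<close>

lemma unitary_reflection:
  fixes c w :: real
  assumes "c\<^sup>2 + w\<^sup>2 = 1"
  shows "unitary_mat (s + s) (four_block_mat (real_diag s (\<lambda>_. c)) (real_diag s (\<lambda>_. w))
    (real_diag s (\<lambda>_. w)) (real_diag s (\<lambda>_. - c)))" (is "unitary_mat _ ?R")
proof -
  have "mat_adjoint ?R = ?R" by (rule eq_matI) (auto simp: mat_diag_def)
  then have "mat_adjoint ?R * ?R = four_block_mat (real_diag s (\<lambda>_. c * c) + real_diag s (\<lambda>_. w * w))
      (real_diag s (\<lambda>_. c * w) + real_diag s (\<lambda>_. w * - c))
      (real_diag s (\<lambda>_. w * c) + real_diag s (\<lambda>_. - c * w))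
      (real_diag s (\<lambda>_. w * w) + real_diag s (\<lambda>_. - c * - c))"
    by (simp only:) (subst mult_four_block_mat[of _ s s _ s _ s _ _ s _ s], auto)
  also have "\<dots> = 1\<^sub>m (s + s)"
  proof -
    have "complex_of_real c * complex_of_real c + complex_of_real w * complex_of_real w = 1"
      using assms by (simp add: power2_eq_square flip: of_real_mult of_real_add)
    then show ?thesis by (intro eq_matI) (auto simp: mat_diag_def add.commute)
  qed
  finally show ?thesis by (auto simp: unitary_mat_def intro!: carrier_matI)
qed

text \<open>
  The pair is \<open>D = diag d\<close> and \<open>diag e * R\<close> with the reflection \<open>R\<close>. For each \<open>i < r\<close> the right
  singular vectors number \<open>i\<close> of the two matrices enclose an angle with cosine \<open>c\<close>, the left ones
  coincide, and all other pairs are orthogonal. The cosine therefore enters the cross term of the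
  matrices once and that of the positive factors, where it occurs on both sides, twice. The size
  \<open>2 s\<close> leaves room for the second vector of each plane.
\<close>

lemma extremal_polar_pair:
  assumes d: "decreasing_spectrum r d" and e: "decreasing_spectrum s e" and rs: "r \<le> s"
    and c: "\<bar>c\<bar> \<le> 1"
  shows "\<exists>B Bt P K Pt Kt. gen_polar_decomposition (s + s) (s + s) B P K \<and>
    gen_polar_decomposition (s + s) (s + s) Bt Pt Kt \<and>
    vec_space.rank (s + s) B = r \<and> vec_space.rank (s + s) Bt = s \<and>
    nonzero_singular_values B = map d [0..<r] \<and> nonzero_singular_values Bt = map e [0..<s] \<and>
    Re (mat_trace (mat_adjoint B * Bt)) = c * (\<Sum>i<r. d i * e i) \<and>
    Re (mat_trace (K * Kt)) = c\<^sup>2 * (\<Sum>i<r. d i * e i)"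
proof -
  let ?n = "s + s"
  define w where "w = sqrt (1 - c\<^sup>2)"
  have "c\<^sup>2 \<le> 1" using c by (simp add: abs_square_le_1)
  then have cw: "c\<^sup>2 + w\<^sup>2 = 1" by (simp add: w_def)
  define R where "R = four_block_mat (real_diag s (\<lambda>_. c)) (real_diag s (\<lambda>_. w))
    (real_diag s (\<lambda>_. w)) (real_diag s (\<lambda>_. - c))"
  have R: "unitary_mat ?n R" unfolding R_def by (rule unitary_reflection[OF cw])
  note RD [simp] = unitary_matD[OF R]
  have R_index: "R $$ (i, j) = (if i = j then complex_of_real c else 0)" if "i < s" "j < s" for i j
    using that by (simp add: R_def mat_diag_def)
  let ?D = "real_diag ?n d" and ?E = "real_diag ?n e"
  define K where "K = mat_adjoint (1\<^sub>m ?n) * ?D * 1\<^sub>m ?n"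
  define Kt where "Kt = mat_adjoint R * ?E * R"
  have K: "K = ?D" by (simp add: K_def)
  have B: "?D * 1\<^sub>m ?n = ?D" by simp
  have "r \<le> ?n" "s \<le> ?n" using rs by simp_all
  note polarB = gen_polar_decomposition_diag_unitary[OF unitary_mat_one d this(1), folded K_def, unfolded B]
    and polarBt = gen_polar_decomposition_diag_unitary[OF R e this(2), folded Kt_def]
  have d0: "d i = 0" if "r \<le> i" for i using decreasing_spectrum_zero[OF d that] .
  have e0: "e i = 0" if "s \<le> i" for i using decreasing_spectrum_zero[OF e that] .
  have "mat_trace (mat_adjoint ?D * (?E * R)) = (\<Sum>i<?n. d i * (e i * R $$ (i, i)))"
    unfolding mat_adjoint_real_diag by (simp add: mat_trace_def mat_diag_mult_left[of _ ?n ?n])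
  also have "\<dots> = (\<Sum>i<r. d i * (e i * R $$ (i, i)))"
    using rs d0 by (intro sum.mono_neutral_right) auto
  also have "\<dots> = (\<Sum>i<r. complex_of_real (c * (d i * e i)))"
    using rs by (intro sum.cong) (auto simp: R_index)
  finally have trB: "Re (mat_trace (mat_adjoint ?D * (?E * R))) = c * (\<Sum>i<r. d i * e i)"
    by (simp add: sum_distrib_left)
  have "mat_trace (K * Kt) = mat_trace (Kt * K)"
    by (rule mat_trace_mult_commute) (simp_all add: K Kt_def)
  also have "Kt * K = mat_adjoint R * (?E * R * ?D)"
    by (simp add: K Kt_def mat_mult_assoc)
  also have "mat_trace \<dots> = complex_of_real (\<Sum>i<?n. \<Sum>j<?n. e i * d j * (cmod (R $$ (i, j)))\<^sup>2)"
    by (rule mat_trace_real_diag_sandwich) simp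
  also have "(\<Sum>i<?n. \<Sum>j<?n. e i * d j * (cmod (R $$ (i, j)))\<^sup>2) =
      (\<Sum>j<?n. \<Sum>i<?n. e i * d j * (cmod (R $$ (i, j)))\<^sup>2)" by (rule sum.swap)
  also have "\<dots> = (\<Sum>j<r. \<Sum>i<?n. e i * d j * (cmod (R $$ (i, j)))\<^sup>2)"
    using rs d0 by (intro sum.mono_neutral_right) auto
  also have "\<dots> = (\<Sum>j<r. c\<^sup>2 * (d j * e j))"
  proof (intro sum.cong refl)
    fix j assume "j \<in> {..<r}"
    then have j: "j < s" using rs by simp
    have "(\<Sum>i<?n. e i * d j * (cmod (R $$ (i, j)))\<^sup>2) = (\<Sum>i\<in>{j}. e i * d j * (cmod (R $$ (i, j)))\<^sup>2)"
    proof (intro sum.mono_neutral_right ballI)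
      fix i assume "i \<in> {..<?n} - {j}"
      then show "e i * d j * (cmod (R $$ (i, j)))\<^sup>2 = 0"
        using e0[of i] R_index[of i j] j by (cases "i < s") auto
    qed (use j in auto)
    then show "(\<Sum>i<?n. e i * d j * (cmod (R $$ (i, j)))\<^sup>2) = c\<^sup>2 * (d j * e j)"
      using R_index[OF j j] by simp
  qed
  finally have trK: "Re (mat_trace (K * Kt)) = c\<^sup>2 * (\<Sum>i<r. d i * e i)"
    by (simp add: sum_distrib_left)
  show ?thesis
    by (intro exI conjI) (rule polarB polarBt trB trK)+
qed

text \<open>
  The extremal pair with \<open>c = \<delta> / (2 G)\<close> has \<open>t = c\<^sup>2 G = \<delta>\<^sup>2 / (4 G)\<close>, the point where the quotient
  of the squared norms attains its maximum \<open>G / \<delta>\<close>; the cross term \<open>u = c G\<close> is \<open>\<surd>(G t)\<close>.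
\<close>

lemma polar_coefficient_optimal:
  fixes \<kappa> :: real
  assumes A: "gen_polar_decomposition m n A Q H" and At: "gen_polar_decomposition m n At Qt Ht"
    and ranks: "vec_space.rank m A = r" "vec_space.rank m At = s" and rs: "1 \<le> r" "r \<le> s"
    and bound: "\<And>m' n' B Bt P K Pt Kt. gen_polar_decomposition m' n' B P K \<Longrightarrow>
        gen_polar_decomposition m' n' Bt Pt Kt \<Longrightarrow>
        vec_space.rank m' B = r \<Longrightarrow> vec_space.rank m' Bt = s \<Longrightarrow>
        nonzero_singular_values B = nonzero_singular_values A \<Longrightarrow>
        nonzero_singular_values Bt = nonzero_singular_values At \<Longrightarrow>
        frobenius_norm (B + Bt) \<le> \<kappa> * frobenius_norm (K + Kt)"
  shows "polar_coefficient r s A At \<le> \<kappa>"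
proof -
  define F where "F = F_sum r s A At"
  define G where "G = G_sum r A At"
  define \<delta> where "\<delta> = sqrt (F\<^sup>2 + 2 * G * F) - F"
  define c where "c = \<delta> / (2 * G)"
  obtain d where d: "decreasing_spectrum r d" and nsvA: "nonzero_singular_values A = map d [0..<r]"
    using gen_polar_decomposition_spectrum[OF A, unfolded ranks] by blast
  obtain e where e: "decreasing_spectrum s e" and nsvAt: "nonzero_singular_values At = map e [0..<s]"
    using gen_polar_decomposition_spectrum[OF At, unfolded ranks] by blast
  note FG = F_sum_G_sum_decreasing_spectrum[OF d e rs nsvA nsvAt, folded F_def G_def]
  note gap = polar_gap[OF FG(1,2), folded \<delta>_def]
  have "\<bar>c\<bar> \<le> 1" using gap FG(2) by (simp add: c_def)
  then obtain B Bt P K Pt Kt where B: "gen_polar_decomposition (s + s) (s + s) B P K"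
    and Bt: "gen_polar_decomposition (s + s) (s + s) Bt Pt Kt"
    and rank: "vec_space.rank (s + s) B = r" "vec_space.rank (s + s) Bt = s"
    and nsv: "nonzero_singular_values B = map d [0..<r]" "nonzero_singular_values Bt = map e [0..<s]"
    and tr: "Re (mat_trace (mat_adjoint B * Bt)) = c * (\<Sum>i<r. d i * e i)"
      "Re (mat_trace (K * Kt)) = c\<^sup>2 * (\<Sum>i<r. d i * e i)"
    using extremal_polar_pair[OF d e rs(2)] by blast
  have F: "F_sum r s B Bt = F" by (simp add: F_def F_sum_def nsv nsvA nsvAt)
  have G: "(\<Sum>i<r. d i * e i) = G" using FG(3)[of r] by simp
  have num: "(frobenius_norm (B + Bt))\<^sup>2 = F + 2 * (c * G)"
    and den: "(frobenius_norm (K + Kt))\<^sup>2 = F + 2 * (c\<^sup>2 * G)"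
    using gen_polar_decomposition_norms_add[OF B Bt] by (simp_all add: rank F tr G)
  have "0 < F + 2 * (c\<^sup>2 * G)" using FG by (intro add_pos_nonneg) auto
  then have pos: "0 < frobenius_norm (K + Kt)"
    unfolding den[symmetric] using frobenius_norm_nonneg[of "K + Kt"] by (simp add: zero_less_power_eq less_le)
  have "G / \<delta> * (F + 2 * (c\<^sup>2 * G)) = (2 * G * F + \<delta>\<^sup>2) / (2 * \<delta>)"
    using FG(2) gap(1) by (simp add: c_def field_simps power2_eq_square)
  also have "2 * G * F + \<delta>\<^sup>2 = 2 * \<delta> * (F + \<delta>)" using gap(2) by (simp add: power2_eq_square algebra_simps)
  also have "2 * \<delta> * (F + \<delta>) / (2 * \<delta>) = F + 2 * (c * G)"
    using FG(2) gap(1) by (simp add: c_def)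
  finally have "(polar_coefficient r s A At * frobenius_norm (K + Kt))\<^sup>2 = (frobenius_norm (B + Bt))\<^sup>2"
    unfolding num power_mult_distrib den
    using FG(2) gap(1) by (simp add: polar_coefficient_def flip: F_def G_def \<delta>_def)
  moreover have "0 \<le> polar_coefficient r s A At"
    using FG(2) gap(1) by (simp add: polar_coefficient_def flip: F_def G_def \<delta>_def)
  ultimately have "polar_coefficient r s A At * frobenius_norm (K + Kt) = frobenius_norm (B + Bt)"
    by (rule power2_eq_imp_eq[OF _ mult_nonneg_nonneg]) (rule frobenius_norm_nonneg)+
  also have "\<dots> \<le> \<kappa> * frobenius_norm (K + Kt)"
    by (rule bound[OF B Bt rank]) (simp_all add: nsv nsvA nsvAt)
  finally show ?thesis using pos by simp
qed

theorem theorem1p12: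
  fixes m n r s :: nat and A At E Q H Qt Ht :: "complex mat"
  assumes "1 \<le> r" and "r \<le> s"
    and "A \<in> carrier_mat m n" and "E \<in> carrier_mat m n" and "At = A + E"
    and "vec_space.rank m A = r" and "vec_space.rank m At = s"
    and "gen_polar_decomposition m n A Q H"
    and "gen_polar_decomposition m n At Qt Ht"
  shows "frobenius_norm (A + At) \<le> polar_coefficient r s A At * frobenius_norm (H + Ht)
    \<and> (\<forall>c::real.
         (\<forall>m' n' B Bt P K Pt Kt.
            gen_polar_decomposition m' n' B P K \<and>
            gen_polar_decomposition m' n' Bt Pt Kt \<and>
            vec_space.rank m' B = r \<and> vec_space.rank m' Bt = s \<and>
            nonzero_singular_values B = nonzero_singular_values A \<and>
            nonzero_singular_values Bt = nonzero_singular_values At \<longrightarrow>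
            frobenius_norm (B + Bt) \<le> c * frobenius_norm (K + Kt))
         \<longrightarrow> polar_coefficient r s A At \<le> c)"
proof (intro conjI allI impI)
  show "frobenius_norm (A + At) \<le> polar_coefficient r s A At * frobenius_norm (H + Ht)"
    using assms by (intro frobenius_norm_add_le_polar_coefficient)
  show "polar_coefficient r s A At \<le> c"
    if "\<forall>m' n' B Bt P K Pt Kt.
            gen_polar_decomposition m' n' B P K \<and>
            gen_polar_decomposition m' n' Bt Pt Kt \<and>
            vec_space.rank m' B = r \<and> vec_space.rank m' Bt = s \<and>
            nonzero_singular_values B = nonzero_singular_values A \<and>
            nonzero_singular_values Bt = nonzero_singular_values At \<longrightarrow>
            frobenius_norm (B + Bt) \<le> c * frobenius_norm (K + Kt)" for c
    by (rule polar_coefficient_optimal[OF assms(8,9,6,7,1,2)]) (use that in blast)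
qed

end
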